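(* Let $\theta\in H^\infty$ be an inner function, let $\phi,\psi\in L^\infty$ be unimodular with $\phi K_\theta\perp\psi K_\theta$ and such that neither $\phi\overline\psi$ nor $\overline\phi\psi$ is a constant multiple of $\theta$, and let $M=\phi K_\theta\oplus\psi K_\theta$. Let $g\in L^2$ be such that the dual-band Toeplitz operator $T^M_g$ is bounded on $M$. Then $T^M_g$ is unitarily equivalent to the block truncated Toeplitz operator $$W=\begin{pmatrix} A^\theta_g & A^\theta_{\overline\phi\psi g}\\ A^\theta_{\overline\psi\phi g} & A^\theta_g\end{pmatrix}$$ on $K_\theta\oplus K_\theta$. Hence $T^M_g=0$ if and only if each of the four truncated Toeplitz operators composing $W$ is $0$.
   Context: All function spaces are on the unit circle $\mathbb T$: $L^p=L^p(\mathbb T)$, and $H^2,H^\infty$ are the Hardy spaces of the unit disc identified with their boundary values. For $\theta$ inner, $K_\theta=H^2\ominus\theta H^2$ and $P_\theta$ is the orthogonal projection from $L^2$ onto $K_\theta$. For $g\in L^2$, the truncated Toeplitz operator is $A^\theta_g f=P_\theta(gf)$ for $f\in K_\theta\cap L^\infty$ (a dense subspace of $K_\theta$); if bounded, $A^\theta_g$ also denotes its bounded extension to $K_\theta$. $M=\phi K_\theta\oplus\psi K_\theta$ (orthogonal sum) is a closed subspace of $L^2$ with orthogonal projection $P_M$. For $g\in L^2$, $T^M_g f=P_M(gf)$ for $f\in L^\infty\cap M$ (dense in $M$); if this operator is bounded, $T^M_g$ also denotes its unique bounded extension to $M$. *)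

theory Defs
  imports "HOL-Complex_Analysis.Complex_Analysis" "HOL-Probability.Probability"
begin

text \<open>
  The space is the circle itself rather than the complex plane: a function which is continuous on
  the circle is then measurable whatever its values elsewhere, as needed for dilates of functions
  holomorphic in the disc.
\<close>

definition circle_measure :: "complex measure" where
  "circle_measure =
     distr (uniform_measure lborel {0..2 * pi}) (restrict_space borel (sphere 0 1)) cis"

lemma space_circle_measure [simp]: "space circle_measure = sphere 0 1"
  by (simp add: circle_measure_def space_restrict_space)

lemma prob_space_circle_measure: "prob_space circle_measure"
proof -
  have "prob_space (uniform_measure lborel {0..2 * pi :: real})"
    by (intro prob_space_uniform_measure) auto
  moreover have "cis \<in> borel \<rightarrow>\<^sub>M restrict_space borel (sphere 0 1)"
    by (intro measurable_restrict_space2 borel_measurable_continuous_onI)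
       (auto intro!: continuous_intros simp: cis_conv_exp)
  hence "cis \<in> uniform_measure lborel {0..2 * pi} \<rightarrow>\<^sub>M restrict_space borel (sphere 0 1)"
    by (simp cong: measurable_cong_sets)
  ultimately show ?thesis
    unfolding circle_measure_def by (rule prob_space.prob_space_distr)
qed

text \<open>
  Measurable functions on the circle modulo equality almost everywhere.  The function spaces
  \<open>L\<^sup>2\<close>, \<open>L\<^sup>\<infinity>\<close>, \<open>H\<^sup>2\<close>, \<open>H\<^sup>\<infinity>\<close> below are subsets of this type, so that equality of their elements
  is genuine equality and products of functions are the multiplication of a commutative ring.
\<close>

definition ae_rel :: "(complex \<Rightarrow> complex) \<Rightarrow> (complex \<Rightarrow> complex) \<Rightarrow> bool" where
  "ae_rel f g \<longleftrightarrow> f \<in> borel_measurable circle_measure \<and> g \<in> borel_measurable circle_measure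
      \<and> (AE z in circle_measure. f z = g z)"

quotient_type circle_fun = "complex \<Rightarrow> complex" / partial: ae_rel
proof (rule part_equivpI)
  show "\<exists>f. ae_rel f f"
    by (rule exI[of _ "\<lambda>_. 0"]) (simp add: ae_rel_def)
  show "symp ae_rel"
    by (rule sympI) (auto simp: ae_rel_def elim: eventually_mono)
  show "transp ae_rel"
    by (rule transpI) (auto simp: ae_rel_def elim: eventually_elim2)
qed

instantiation circle_fun :: comm_ring_1
begin

lift_definition zero_circle_fun :: circle_fun is "\<lambda>_. 0"
  by (simp add: ae_rel_def)

lift_definition one_circle_fun :: circle_fun is "\<lambda>_. 1"
  by (simp add: ae_rel_def)

lift_definition plus_circle_fun :: "circle_fun \<Rightarrow> circle_fun \<Rightarrow> circle_fun"
  is "\<lambda>f g z. f z + g z"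
  by (auto simp: ae_rel_def)

lift_definition minus_circle_fun :: "circle_fun \<Rightarrow> circle_fun \<Rightarrow> circle_fun"
  is "\<lambda>f g z. f z - g z"
  by (auto simp: ae_rel_def)

lift_definition uminus_circle_fun :: "circle_fun \<Rightarrow> circle_fun"
  is "\<lambda>f z. - f z"
  by (auto simp: ae_rel_def)

lift_definition times_circle_fun :: "circle_fun \<Rightarrow> circle_fun \<Rightarrow> circle_fun"
  is "\<lambda>f g z. f z * g z"
  by (auto simp: ae_rel_def)

instance
proof
  fix a b c :: circle_fun
  show "a * b * c = a * (b * c)" by transfer (auto simp: ae_rel_def algebra_simps)
  show "a * b = b * a" by transfer (auto simp: ae_rel_def algebra_simps)
  show "1 * a = a" by transfer (auto simp: ae_rel_def)
  show "a + b + c = a + (b + c)" by transfer (auto simp: ae_rel_def algebra_simps)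
  show "a + b = b + a" by transfer (auto simp: ae_rel_def algebra_simps)
  show "0 + a = a" by transfer (auto simp: ae_rel_def)
  show "- a + a = 0" by transfer (auto simp: ae_rel_def)
  show "a - b = a + - b" by transfer (auto simp: ae_rel_def)
  show "(a + b) * c = a * c + b * c" by transfer (auto simp: ae_rel_def algebra_simps)
  interpret prob_space circle_measure by (rule prob_space_circle_measure)
  show "(0::circle_fun) \<noteq> 1" by transfer (auto simp: ae_rel_def AE_False)
qed

end

lemma borel_measurable_cnj_comp [measurable (raw)]:
  "f \<in> borel_measurable M \<Longrightarrow> (\<lambda>z. cnj (f z)) \<in> borel_measurable M"
  by (rule measurable_compose[OF _ borel_measurable_continuous_onI])
     (auto intro: continuous_intros)

lift_definition const_fun :: "complex \<Rightarrow> circle_fun" is "\<lambda>c _. c"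
  by (simp add: ae_rel_def)

lift_definition cnj_fun :: "circle_fun \<Rightarrow> circle_fun" is "\<lambda>f z. cnj (f z)"
  by (auto simp: ae_rel_def)


subsection \<open>Lebesgue spaces\<close>

lift_definition in_L2 :: "circle_fun \<Rightarrow> bool"
  is "\<lambda>f. integrable circle_measure (\<lambda>z. (cmod (f z))\<^sup>2)"
  unfolding ae_rel_def by (intro integrable_cong_AE) (auto elim: eventually_mono)

lift_definition in_Linf :: "circle_fun \<Rightarrow> bool"
  is "\<lambda>f. \<exists>C. AE z in circle_measure. cmod (f z) \<le> C"
  unfolding ae_rel_def by (safe; fastforce elim: eventually_elim2)

definition L2 :: "circle_fun set" where "L2 = {f. in_L2 f}"

definition Linf :: "circle_fun set" where "Linf = {f. in_Linf f}"

lift_definition unimodular :: "circle_fun \<Rightarrow> bool"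
  is "\<lambda>f. AE z in circle_measure. cmod (f z) = 1"
  unfolding ae_rel_def by (safe; fastforce elim: eventually_elim2)

lift_definition ip :: "circle_fun \<Rightarrow> circle_fun \<Rightarrow> complex"
  is "\<lambda>f g. LINT z|circle_measure. f z * cnj (g z)"
  unfolding ae_rel_def
  by (intro integral_cong_AE) (auto elim: eventually_elim2)

lift_definition L2_norm :: "circle_fun \<Rightarrow> real"
  is "\<lambda>f. sqrt (LINT z|circle_measure. (cmod (f z))\<^sup>2)"
  unfolding ae_rel_def
  by (intro arg_cong[where f = sqrt] integral_cong_AE) (auto elim: eventually_mono)

definition orthogonal_sets :: "circle_fun set \<Rightarrow> circle_fun set \<Rightarrow> bool" where
  "orthogonal_sets A B \<longleftrightarrow> (\<forall>a\<in>A. \<forall>b\<in>B. ip a b = 0)"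

definition times_set :: "circle_fun \<Rightarrow> circle_fun set \<Rightarrow> circle_fun set" where
  "times_set u A = (\<lambda>a. u * a) ` A"

definition sum_set :: "circle_fun set \<Rightarrow> circle_fun set \<Rightarrow> circle_fun set" where
  "sum_set A B = {a + b | a b. a \<in> A \<and> b \<in> B}"

text \<open>Orthogonal projection onto \<open>S\<close>; only meaningful for closed subspaces \<open>S\<close> of \<open>L\<^sup>2\<close> and \<open>f \<in> L\<^sup>2\<close>.\<close>

definition proj :: "circle_fun set \<Rightarrow> circle_fun \<Rightarrow> circle_fun" where
  "proj S f = (THE p. p \<in> S \<and> (\<forall>h\<in>S. ip (f - p) h = 0))"


subsection \<open>Hardy spaces of the disc, identified with their boundary values\<close>

text \<open>
  \<open>f\<close> is the boundary function of \<open>F\<close>: the dilates \<open>F(r \<cdot>)\<close> converge to \<open>f\<close> in \<open>L\<^sup>2\<close> of the circle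
  as \<open>r \<rightarrow> 1\<close>.  For functions of the Hardy spaces \<open>H\<^sup>2\<close> and \<open>H\<^sup>\<infinity>\<close> of the disc this is the same
  as being the almost everywhere radial limit.
\<close>

lift_definition boundary_value :: "(complex \<Rightarrow> complex) \<Rightarrow> circle_fun \<Rightarrow> bool"
  is "\<lambda>F f. ((\<lambda>r::real. \<integral>\<^sup>+z. ennreal ((cmod (F (of_real r * z) - f z))\<^sup>2) \<partial>circle_measure)
              \<longlongrightarrow> 0) (at_left 1)"
proof -
  fix F f g assume "ae_rel f g"
  hence "AE z in circle_measure. f z = g z" by (simp add: ae_rel_def)
  hence "(\<integral>\<^sup>+z. ennreal ((cmod (F (of_real r * z) - f z))\<^sup>2) \<partial>circle_measure) =
         (\<integral>\<^sup>+z. ennreal ((cmod (F (of_real r * z) - g z))\<^sup>2) \<partial>circle_measure)" for r :: real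
    by (intro nn_integral_cong_AE) (auto elim: eventually_mono)
  thus "((\<lambda>r::real. \<integral>\<^sup>+z. ennreal ((cmod (F (of_real r * z) - f z))\<^sup>2) \<partial>circle_measure)
            \<longlongrightarrow> 0) (at_left 1) =
        ((\<lambda>r::real. \<integral>\<^sup>+z. ennreal ((cmod (F (of_real r * z) - g z))\<^sup>2) \<partial>circle_measure)
            \<longlongrightarrow> 0) (at_left 1)"
    by simp
qed

definition hardy2_disc :: "(complex \<Rightarrow> complex) \<Rightarrow> bool" where
  "hardy2_disc F \<longleftrightarrow> F holomorphic_on ball 0 1 \<and>
     (\<exists>C::real. \<forall>r\<in>{0..<1}.
        (\<integral>\<^sup>+z. ennreal ((cmod (F (of_real r * z)))\<^sup>2) \<partial>circle_measure) \<le> ennreal C)"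

definition hardy_inf_disc :: "(complex \<Rightarrow> complex) \<Rightarrow> bool" where
  "hardy_inf_disc F \<longleftrightarrow> F holomorphic_on ball 0 1 \<and> bounded (F ` ball 0 1)"

definition H2 :: "circle_fun set" where
  "H2 = {f \<in> L2. \<exists>F. hardy2_disc F \<and> boundary_value F f}"

definition Hinf :: "circle_fun set" where
  "Hinf = {f \<in> Linf. \<exists>F. hardy_inf_disc F \<and> boundary_value F f}"

definition inner_function :: "circle_fun \<Rightarrow> bool" where
  "inner_function \<theta> \<longleftrightarrow> \<theta> \<in> Hinf \<and> unimodular \<theta>"

definition model_space :: "circle_fun \<Rightarrow> circle_fun set" where
  "model_space \<theta> = {f \<in> H2. \<forall>h\<in>H2. ip f (\<theta> * h) = 0}"


subsection \<open>Compressed multiplication operators\<close>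

definition bounded_compression :: "circle_fun set \<Rightarrow> circle_fun \<Rightarrow> bool" where
  "bounded_compression S g \<longleftrightarrow>
     (\<exists>C. \<forall>f\<in>S \<inter> Linf. L2_norm (proj S (g * f)) \<le> C * L2_norm f)"

definition bounded_operator :: "circle_fun set \<Rightarrow> (circle_fun \<Rightarrow> circle_fun) \<Rightarrow> bool" where
  "bounded_operator S B \<longleftrightarrow>
     (\<forall>f\<in>S. B f \<in> S) \<and>
     (\<forall>f\<in>S. \<forall>h\<in>S. B (f + h) = B f + B h) \<and>
     (\<forall>c. \<forall>f\<in>S. B (const_fun c * f) = const_fun c * B f) \<and>
     (\<exists>C. \<forall>f\<in>S. L2_norm (B f) \<le> C * L2_norm f)"

text \<open>
  The bounded extension to \<open>S\<close> of \<open>f \<mapsto> P\<^sub>S (g f)\<close>, \<open>f \<in> S \<inter> L\<^sup>\<infinity>\<close>.  It is meaningful under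
  \<open>bounded_compression S g\<close> when \<open>S \<inter> L\<^sup>\<infinity>\<close> is dense in the closed subspace \<open>S\<close>; the value \<open>0\<close>
  outside \<open>S\<close> is a convention that makes the function unique.
\<close>

definition compression :: "circle_fun set \<Rightarrow> circle_fun \<Rightarrow> circle_fun \<Rightarrow> circle_fun" where
  "compression S g = (THE B. bounded_operator S B \<and>
     (\<forall>f\<in>S \<inter> Linf. B f = proj S (g * f)) \<and> (\<forall>f. f \<notin> S \<longrightarrow> B f = 0))"

abbreviation TTO_bounded :: "circle_fun \<Rightarrow> circle_fun \<Rightarrow> bool" where
  "TTO_bounded \<theta> g \<equiv> bounded_compression (model_space \<theta>) g"

abbreviation TTO :: "circle_fun \<Rightarrow> circle_fun \<Rightarrow> circle_fun \<Rightarrow> circle_fun" where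
  "TTO \<theta> g \<equiv> compression (model_space \<theta>) g"

definition dual_band :: "circle_fun \<Rightarrow> circle_fun \<Rightarrow> circle_fun \<Rightarrow> circle_fun set" where
  "dual_band \<theta> \<phi> \<psi> =
     sum_set (times_set \<phi> (model_space \<theta>)) (times_set \<psi> (model_space \<theta>))"

definition zero_operator :: "circle_fun set \<Rightarrow> (circle_fun \<Rightarrow> circle_fun) \<Rightarrow> bool" where
  "zero_operator S B \<longleftrightarrow> (\<forall>f\<in>S. B f = 0)"

definition block_operator ::
  "(circle_fun \<Rightarrow> circle_fun) \<Rightarrow> (circle_fun \<Rightarrow> circle_fun) \<Rightarrow>
   (circle_fun \<Rightarrow> circle_fun) \<Rightarrow> (circle_fun \<Rightarrow> circle_fun) \<Rightarrow>
   circle_fun \<times> circle_fun \<Rightarrow> circle_fun \<times> circle_fun" where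
  "block_operator A B C D = (\<lambda>(f, h). (A f + B h, C f + D h))"

text \<open>A unitary map from the Hilbert space direct sum \<open>K \<oplus> K\<close>, with carrier \<open>K \<times> K\<close>, onto \<open>M\<close>.\<close>

definition unitary_from_sum ::
  "circle_fun set \<Rightarrow> circle_fun set \<Rightarrow> (circle_fun \<times> circle_fun \<Rightarrow> circle_fun) \<Rightarrow> bool" where
  "unitary_from_sum K M U \<longleftrightarrow>
     bij_betw U (K \<times> K) M \<and>
     (\<forall>a\<in>K. \<forall>b\<in>K. \<forall>c\<in>K. \<forall>d\<in>K. U (a + c, b + d) = U (a, b) + U (c, d)) \<and>
     (\<forall>k. \<forall>a\<in>K. \<forall>b\<in>K. U (const_fun k * a, const_fun k * b) = const_fun k * U (a, b)) \<and>
     (\<forall>a\<in>K. \<forall>b\<in>K. \<forall>c\<in>K. \<forall>d\<in>K. ip (U (a, b)) (U (c, d)) = ip a c + ip b d)"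

definition unitarily_equivalent_sum ::
  "circle_fun set \<Rightarrow> (circle_fun \<Rightarrow> circle_fun) \<Rightarrow>
   circle_fun set \<Rightarrow> (circle_fun \<times> circle_fun \<Rightarrow> circle_fun \<times> circle_fun) \<Rightarrow> bool" where
  "unitarily_equivalent_sum M T K W \<longleftrightarrow>
     (\<exists>U. unitary_from_sum K M U \<and> (\<forall>x\<in>K \<times> K. T (U x) = U (W x)))"

end

theory Submission
  imports Defs
begin

text \<open>
  By unimodularity and the orthogonality of the two bands, \<open>U (a, b) = \<phi> a + \<psi> b\<close> is a unitary map
  from the orthogonal sum of two copies of the model space \<open>K\<close> onto \<open>M\<close>, and
  \<open>P\<^sub>M f = U (P\<^sub>K (cnj \<phi> f), P\<^sub>K (cnj \<psi> f))\<close>.  On bounded components this gives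
  \<open>P\<^sub>M (g U (a, b)) = U (W (a, b))\<close>, which bounds the four entries of \<open>W\<close>.  The
  bounded extensions exist because \<open>L\<^sup>2\<close> is complete and \<open>K\<close> is closed with dense bounded part: the
  projections \<open>p - \<theta> q\<close> of analytic polynomials \<open>p\<close> onto \<open>K\<close> are bounded, \<open>q\<close> being a polynomial.
\<close>

subsection \<open>Square-integrable and bounded functions on the circle\<close>

text \<open>\<open>proj\<close> and \<open>compression\<close> are definite descriptions, so each
  use owes existence and uniqueness. On the model space existence is an extension by continuity. On
  \<open>M\<close> the operator is transported instead: \<open>B\<close> is \<open>W\<close> carried
  over by \<open>U\<close>, and \<open>compression_eqI\<close> recognizes it as the compression. The
  obstacle is that \<open>B\<close> must agree with \<open>proj M (g * f)\<close> at every bounded f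
  in \<open>M\<close>, while the block formula needs both components of f to be bounded; the assumed
  bound on the compression closes this gap by density.

  The Hardy space is given by holomorphic functions and their dilates, but the arguments need it as
  a closed subspace of \<open>L2\<close>. The bridge is \<open>H2_iff\<close>, which identifies it
  with the closure of the analytic polynomials. One direction truncates Taylor series of dilates,
  the other rebuilds a holomorphic function from Fourier coefficients. From there on closedness,
  orthogonality and density are approximations by polynomials.\<close>

interpretation circle: prob_space circle_measure
  by (rule prob_space_circle_measure)

text \<open>Serves arguments that need one fixed measurable function, such as pointwise limits and
  Fatou, rather than a statement lifted by \<open>transfer\<close>.\<close>

lemma circle_fun_representative:
  obtains F where "F \<in> borel_measurable circle_measure" "f = abs_circle_fun F"
proof -
  have "ae_rel (rep_circle_fun f) (rep_circle_fun f)"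
    using Quotient_rep_reflp[OF Quotient_circle_fun] .
  moreover have "f = abs_circle_fun (rep_circle_fun f)"
    using Quotient_abs_rep[OF Quotient_circle_fun] by metis
  ultimately show ?thesis
    using that by (auto simp: ae_rel_def)
qed

lemma in_L2_abs:
  assumes "F \<in> borel_measurable circle_measure"
  shows "abs_circle_fun F \<in> L2 \<longleftrightarrow> integrable circle_measure (\<lambda>z. (cmod (F z))\<^sup>2)"
  using assms by (simp add: L2_def in_L2.abs_eq ae_rel_def)

lemma L2_add [intro]: "f \<in> L2 \<Longrightarrow> g \<in> L2 \<Longrightarrow> f + g \<in> L2"
  unfolding L2_def mem_Collect_eq
proof (transfer, unfold ae_rel_def, elim conjE)
  fix f g :: "complex \<Rightarrow> complex"
  assume [measurable]: "f \<in> borel_measurable circle_measure" "g \<in> borel_measurable circle_measure"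
    and i: "integrable circle_measure (\<lambda>z. (cmod (f z))\<^sup>2)" "integrable circle_measure (\<lambda>z. (cmod (g z))\<^sup>2)"
  show "integrable circle_measure (\<lambda>z. (cmod (f z + g z))\<^sup>2)"
  proof (rule Bochner_Integration.integrable_bound)
    show "integrable circle_measure (\<lambda>z. 2 * (cmod (f z))\<^sup>2 + 2 * (cmod (g z))\<^sup>2)"
      using i by auto
    have "(cmod (a + b))\<^sup>2 \<le> 2 * (cmod a)\<^sup>2 + 2 * (cmod b)\<^sup>2" for a b :: complex
      using power_mono[OF norm_triangle_ineq[of a b], of 2] sum_squares_bound[of "cmod a" "cmod b"]
      by (simp add: power2_sum)
    thus "AE z in circle_measure. norm ((cmod (f z + g z))\<^sup>2) \<le> norm (2 * (cmod (f z))\<^sup>2 + 2 * (cmod (g z))\<^sup>2)"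
      by simp
  qed measurable
qed

lemma Linf_times_L2 [intro]: "u \<in> Linf \<Longrightarrow> f \<in> L2 \<Longrightarrow> u * f \<in> L2"
  unfolding L2_def Linf_def mem_Collect_eq
proof (transfer, unfold ae_rel_def, elim conjE exE)
  fix u f :: "complex \<Rightarrow> complex" and C
  assume [measurable]: "f \<in> borel_measurable circle_measure" "u \<in> borel_measurable circle_measure"
    and i: "integrable circle_measure (\<lambda>z. (cmod (f z))\<^sup>2)" and b: "AE z in circle_measure. cmod (u z) \<le> C"
  show "integrable circle_measure (\<lambda>z. (cmod (u z * f z))\<^sup>2)"
  proof (rule Bochner_Integration.integrable_bound)
    show "integrable circle_measure (\<lambda>z. C\<^sup>2 * (cmod (f z))\<^sup>2)"
      using i by auto
    show "AE z in circle_measure. norm ((cmod (u z * f z))\<^sup>2) \<le> norm (C\<^sup>2 * (cmod (f z))\<^sup>2)"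
      using b by eventually_elim (simp add: norm_mult power_mult_distrib mult_right_mono power_mono)
  qed measurable
qed

lemma const_fun_Linf [simp]: "const_fun c \<in> Linf"
  unfolding Linf_def mem_Collect_eq by transfer auto

lemma one_L2: "1 \<in> L2"
  unfolding L2_def mem_Collect_eq by transfer auto

lemma Linf_add [intro]: "f \<in> Linf \<Longrightarrow> g \<in> Linf \<Longrightarrow> f + g \<in> Linf"
  unfolding Linf_def mem_Collect_eq
proof (transfer, elim exE)
  fix f g :: "complex \<Rightarrow> complex" and C D
  assume "AE z in circle_measure. cmod (f z) \<le> C" "AE z in circle_measure. cmod (g z) \<le> D"
  hence "AE z in circle_measure. cmod (f z + g z) \<le> C + D"
    by eventually_elim (rule norm_triangle_mono)
  thus "\<exists>C. AE z in circle_measure. cmod (f z + g z) \<le> C" ..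
qed

lemma Linf_mult [intro]: "f \<in> Linf \<Longrightarrow> g \<in> Linf \<Longrightarrow> f * g \<in> Linf"
  unfolding Linf_def mem_Collect_eq
proof (transfer, elim exE)
  fix f g :: "complex \<Rightarrow> complex" and C D
  assume "AE z in circle_measure. cmod (f z) \<le> C" "AE z in circle_measure. cmod (g z) \<le> D"
  hence "AE z in circle_measure. cmod (f z * g z) \<le> C * D"
  proof eventually_elim
    case (elim z)
    thus ?case unfolding norm_mult using norm_ge_zero order_trans by (blast intro: mult_mono)
  qed
  thus "\<exists>C. AE z in circle_measure. cmod (f z * g z) \<le> C" ..
qed

lemma cnj_Linf [intro]: "f \<in> Linf \<Longrightarrow> cnj_fun f \<in> Linf"
  unfolding Linf_def mem_Collect_eq by transfer auto

lemma Linf_subset_L2: "f \<in> Linf \<Longrightarrow> f \<in> L2"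
  using Linf_times_L2[OF _ one_L2] by auto

lemma unimodular_Linf: "unimodular u \<Longrightarrow> u \<in> Linf"
  unfolding Linf_def mem_Collect_eq
  by transfer (auto intro!: exI[of _ 1] elim: eventually_mono)

lemma cnj_unimodular: "unimodular u \<Longrightarrow> cnj_fun u * u = 1"
  by transfer (auto simp: ae_rel_def complex_norm_square[symmetric] mult.commute elim!: eventually_mono)

lemma const_fun_simps:
  "const_fun 0 = 0" "const_fun 1 = 1" "const_fun (a + b) = const_fun a + const_fun b"
  "const_fun (a * b) = const_fun a * const_fun b" "const_fun (- a) = - const_fun a"
  by (transfer; simp add: ae_rel_def)+

lemma L2_const [intro]: "f \<in> L2 \<Longrightarrow> const_fun c * f \<in> L2"
  by auto

lemma L2_zero [simp]: "0 \<in> L2"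
  using L2_const[OF one_L2, of 0] by (simp add: const_fun_simps)

lemma L2_uminus [intro]: "f \<in> L2 \<Longrightarrow> - f \<in> L2"
  using L2_const[of f "-1"] by (simp add: const_fun_simps)

lemma L2_diff [intro]: "f \<in> L2 \<Longrightarrow> g \<in> L2 \<Longrightarrow> f - g \<in> L2"
  using L2_add[of f "- g"] by auto

subsection \<open>The inner product\<close>

lemma integrable_L2_product:
  assumes [measurable]: "f \<in> borel_measurable circle_measure" "g \<in> borel_measurable circle_measure"
    and i: "integrable circle_measure (\<lambda>z. (cmod (f z))\<^sup>2)" "integrable circle_measure (\<lambda>z. (cmod (g z))\<^sup>2)"
  shows "integrable circle_measure (\<lambda>z. f z * cnj (g z))"
proof (rule Bochner_Integration.integrable_bound)
  show "integrable circle_measure (\<lambda>z. (cmod (f z))\<^sup>2 + (cmod (g z))\<^sup>2)"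
    using i by auto
  have "cmod a * cmod b \<le> (cmod a)\<^sup>2 + (cmod b)\<^sup>2" for a b :: complex
  proof -
    have "0 \<le> cmod a * cmod b" by simp
    with sum_squares_bound[of "cmod a" "cmod b"] show ?thesis by linarith
  qed
  thus "AE z in circle_measure. norm (f z * cnj (g z)) \<le> norm ((cmod (f z))\<^sup>2 + (cmod (g z))\<^sup>2)"
    by (simp add: norm_mult)
qed measurable

lemma ip_add_left: "f \<in> L2 \<Longrightarrow> g \<in> L2 \<Longrightarrow> h \<in> L2 \<Longrightarrow> ip (f + g) h = ip f h + ip g h"
  unfolding L2_def mem_Collect_eq
  by transfer
     (simp add: ae_rel_def distrib_right integrable_L2_product)

lemma ip_adjoint: "ip (u * f) g = ip f (cnj_fun u * g)"
  by transfer (simp add: ac_simps)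

lemma ip_const_left: "ip (const_fun c * f) g = c * ip f g"
  by transfer (simp add: mult.assoc)

lemma ip_commute: "ip g f = cnj (ip f g)"
  by transfer (subst Bochner_Integration.integral_cnj[symmetric], simp add: mult.commute)

lemma ip_const_right: "ip f (const_fun c * g) = cnj c * ip f g"
  using ip_const_left[of c g f] by (metis ip_commute complex_cnj_mult)

lemma ip_add_right: "f \<in> L2 \<Longrightarrow> g \<in> L2 \<Longrightarrow> h \<in> L2 \<Longrightarrow> ip h (f + g) = ip h f + ip h g"
  using ip_add_left[of f g h] by (metis ip_commute complex_cnj_add)

lemma ip_zero [simp]: "ip 0 f = 0" "ip f 0 = 0"
  using ip_const_left[of 0 0 f] ip_const_right[of f 0 0] by (simp_all add: const_fun_simps)

lemma ip_uminus [simp]: "ip (- f) g = - ip f g" "ip f (- g) = - ip f g"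
  using ip_const_left[of "-1" f g] ip_const_right[of f "-1" g] by (simp_all add: const_fun_simps)

lemma ip_diff_left: "f \<in> L2 \<Longrightarrow> g \<in> L2 \<Longrightarrow> h \<in> L2 \<Longrightarrow> ip (f - g) h = ip f h - ip g h"
  using ip_add_left[of f "- g" h] by auto

lemma ip_diff_right: "f \<in> L2 \<Longrightarrow> g \<in> L2 \<Longrightarrow> h \<in> L2 \<Longrightarrow> ip h (f - g) = ip h f - ip h g"
  using ip_add_right[of f "- g" h] by auto

lemma ip_self: "ip f f = of_real ((L2_norm f)\<^sup>2)"
  by transfer (simp add: complex_norm_square[symmetric] flip: of_real_power)

lemma L2_norm_nonneg [simp]: "L2_norm f \<ge> 0"
  by transfer simp

lemma L2_norm_eq: "(L2_norm f)\<^sup>2 = Re (ip f f)"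
  by (simp add: ip_self)

lemma L2_norm_eq_0: "f \<in> L2 \<Longrightarrow> L2_norm f = 0 \<longleftrightarrow> f = 0"
  unfolding L2_def mem_Collect_eq
  by transfer (simp add: ae_rel_def integral_nonneg_eq_0_iff_AE)

lemma L2_norm_0 [simp]: "L2_norm 0 = 0"
  by (simp add: L2_norm_eq_0)

lemma L2_norm_uminus [simp]: "L2_norm (- f) = L2_norm f"
  by transfer simp

lemma L2_norm_minus_commute: "L2_norm (f - g) = L2_norm (g - f)"
  using L2_norm_uminus[of "f - g"] by simp

lemma L2_norm_const: "L2_norm (const_fun c * f) = cmod c * L2_norm f"
  by transfer (simp add: norm_mult power_mult_distrib real_sqrt_mult)

lemma L2_norm_unimodular: "unimodular u \<Longrightarrow> L2_norm (u * f) = L2_norm f"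
  by transfer
     (auto intro!: arg_cong[where f = sqrt] integral_cong_AE simp: ae_rel_def norm_mult elim: eventually_mono)

lemma ip_unimodular: "unimodular u \<Longrightarrow> ip (u * f) (u * g) = ip f g"
  by (simp add: ip_adjoint mult.assoc[symmetric] cnj_unimodular)

lemma L2_norm_add_sq:
  assumes "f \<in> L2" "g \<in> L2"
  shows "(L2_norm (f + g))\<^sup>2 = (L2_norm f)\<^sup>2 + 2 * Re (ip f g) + (L2_norm g)\<^sup>2"
  using assms ip_commute[of f g]
  by (simp add: L2_norm_eq ip_add_left ip_add_right L2_add)

lemma L2_norm_diff_sq:
  assumes "f \<in> L2" "g \<in> L2"
  shows "(L2_norm (f - g))\<^sup>2 = (L2_norm f)\<^sup>2 - 2 * Re (ip f g) + (L2_norm g)\<^sup>2"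
  using L2_norm_add_sq[of f "- g"] assms by (simp add: L2_uminus)

lemma Cauchy_Schwarz_L2:
  assumes "f \<in> L2" "g \<in> L2"
  shows "cmod (ip f g) \<le> L2_norm f * L2_norm g"
proof (cases "L2_norm g = 0")
  case True
  thus ?thesis using assms by (simp add: L2_norm_eq_0)
next
  case False
  define N where "N = (L2_norm g)\<^sup>2"
  have N: "N > 0" using False by (simp add: N_def)
  \<comment> \<open>\<open>const_fun c * g\<close> is the projection of \<open>f\<close> onto the
    line through \<open>g\<close>; the squared norm of the remainder is the Cauchy-Schwarz defect
    divided by \<open>N\<close>.\<close>
  define c where "c = ip f g / of_real N"
  have "0 \<le> (L2_norm (f - const_fun c * g))\<^sup>2" by simp
  also have "\<dots> = (L2_norm f)\<^sup>2 - 2 * Re (cnj c * ip f g) + (cmod c)\<^sup>2 * N"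
    using assms by (simp add: L2_norm_diff_sq L2_const ip_const_right L2_norm_const power_mult_distrib N_def)
  also have "cnj c * ip f g = of_real ((cmod (ip f g))\<^sup>2 / N)"
    using N by (simp add: c_def complex_norm_square[symmetric] mult.commute flip: of_real_power)
  also have "(cmod c)\<^sup>2 * N = (cmod (ip f g))\<^sup>2 / N"
    using N by (simp add: c_def norm_divide power_divide power2_eq_square)
  finally have "(cmod (ip f g))\<^sup>2 / N \<le> (L2_norm f)\<^sup>2" by simp
  hence "(cmod (ip f g))\<^sup>2 \<le> (L2_norm f * L2_norm g)\<^sup>2"
    using N by (simp add: field_simps N_def power_mult_distrib)
  thus ?thesis by (rule power2_le_imp_le) simp
qed

lemma L2_norm_triangle:
  assumes "f \<in> L2" "g \<in> L2"
  shows "L2_norm (f + g) \<le> L2_norm f + L2_norm g"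
proof (rule power2_le_imp_le)
  have "Re (ip f g) \<le> L2_norm f * L2_norm g"
    using Cauchy_Schwarz_L2[OF assms] complex_Re_le_cmod order_trans by blast
  thus "(L2_norm (f + g))\<^sup>2 \<le> (L2_norm f + L2_norm g)\<^sup>2"
    using assms by (simp add: L2_norm_add_sq power2_sum)
qed simp

lemma L2_norm_triangle_diff:
  assumes "f \<in> L2" "g \<in> L2" "h \<in> L2"
  shows "L2_norm (f - h) \<le> L2_norm (f - g) + L2_norm (g - h)"
  using L2_norm_triangle[of "f - g" "g - h"] assms by auto

lemma parallelogram_law:
  assumes "f \<in> L2" "g \<in> L2"
  shows "(L2_norm (f + g))\<^sup>2 + (L2_norm (f - g))\<^sup>2 = 2 * (L2_norm f)\<^sup>2 + 2 * (L2_norm g)\<^sup>2"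
  using assms by (simp add: L2_norm_add_sq L2_norm_diff_sq)

lemma Linf_times_L2_bound:
  assumes "u \<in> Linf"
  obtains C where "C > 0" "\<And>f. f \<in> L2 \<Longrightarrow> L2_norm (u * f) \<le> C * L2_norm f"
proof -
  obtain U where [measurable]: "U \<in> borel_measurable circle_measure" and U: "u = abs_circle_fun U"
    by (rule circle_fun_representative)
  then obtain C0 where C0: "AE z in circle_measure. cmod (U z) \<le> C0"
    using assms by (auto simp: Linf_def in_Linf.abs_eq ae_rel_def)
  \<comment> \<open>The maximum makes the bound positive, so that a later argument may divide by
    it.\<close>
  define C where "C = max C0 1"
  have C: "AE z in circle_measure. cmod (U z) \<le> C" and "C > 0"
    using C0 by (auto simp: C_def elim: eventually_mono)
  have "L2_norm (u * f) \<le> C * L2_norm f" if "f \<in> L2" for f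
  proof -
    obtain F where [measurable]: "F \<in> borel_measurable circle_measure" and F: "f = abs_circle_fun F"
      by (rule circle_fun_representative)
    have i: "integrable circle_measure (\<lambda>z. (cmod (F z))\<^sup>2)"
      using that by (simp add: F in_L2_abs)
    have ae: "AE z in circle_measure. (cmod (U z * F z))\<^sup>2 \<le> C\<^sup>2 * (cmod (F z))\<^sup>2"
      using C by eventually_elim (simp add: norm_mult power_mult_distrib mult_right_mono power_mono)
    have "(LINT z|circle_measure. (cmod (U z * F z))\<^sup>2) \<le> (LINT z|circle_measure. C\<^sup>2 * (cmod (F z))\<^sup>2)"
      using ae i by (intro integral_mono_AE' integrable_mult_right) auto
    also have "\<dots> = C\<^sup>2 * (LINT z|circle_measure. (cmod (F z))\<^sup>2)" by simp
    finally have "sqrt (LINT z|circle_measure. (cmod (U z * F z))\<^sup>2) \<le> C * sqrt (LINT z|circle_measure. (cmod (F z))\<^sup>2)"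
      using \<open>C > 0\<close> by (metis real_sqrt_le_mono real_sqrt_mult real_sqrt_unique less_imp_le)
    thus ?thesis
      by (simp add: U F times_circle_fun.abs_eq L2_norm.abs_eq ae_rel_def)
  qed
  thus ?thesis using that \<open>C > 0\<close> by blast
qed

subsection \<open>Completeness and orthogonal projections\<close>

text \<open>Links the extended nonnegative integrals of \<open>boundary_value\<close> and of Fatou's
  lemma with \<open>L2_norm\<close>; \<open>L2_I_nn_integral\<close> goes the other way and also
  yields membership in \<open>L2\<close>.\<close>

lemma nn_integral_L2_norm:
  assumes [measurable]: "F \<in> borel_measurable circle_measure" and "abs_circle_fun F \<in> L2"
  shows "(\<integral>\<^sup>+z. ennreal ((cmod (F z))\<^sup>2) \<partial>circle_measure) = ennreal ((L2_norm (abs_circle_fun F))\<^sup>2)"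
  using assms
  by (subst nn_integral_eq_integral) (auto simp: in_L2_abs L2_norm.abs_eq ae_rel_def)

lemma L2_I_nn_integral:
  assumes [measurable]: "F \<in> borel_measurable circle_measure"
    and "(\<integral>\<^sup>+z. ennreal ((cmod (F z))\<^sup>2) \<partial>circle_measure) \<le> ennreal (c\<^sup>2)" "c \<ge> 0"
  shows "abs_circle_fun F \<in> L2" "L2_norm (abs_circle_fun F) \<le> c"
proof -
  show *: "abs_circle_fun F \<in> L2"
    unfolding in_L2_abs[OF assms(1)] using assms(2)
    by (intro integrableI_bounded) (auto simp: le_less_trans less_top)
  show "L2_norm (abs_circle_fun F) \<le> c"
    using nn_integral_L2_norm[OF assms(1) *] assms by (auto intro: power2_le_imp_le)
qed

text \<open>On a probability space this is the nonnegativity of the variance of the modulus.\<close>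

lemma nn_integral_le_L2_norm:
  assumes [measurable]: "F \<in> borel_measurable circle_measure" and "abs_circle_fun F \<in> L2"
  shows "(\<integral>\<^sup>+z. ennreal (cmod (F z)) \<partial>circle_measure) \<le> ennreal (L2_norm (abs_circle_fun F))"
proof -
  have i2: "integrable circle_measure (\<lambda>z. (cmod (F z))\<^sup>2)" using assms by (simp add: in_L2_abs)
  have i1: "integrable circle_measure (\<lambda>z. cmod (F z))"
  proof (rule Bochner_Integration.integrable_bound)
    show "integrable circle_measure (\<lambda>z. 1 + (cmod (F z))\<^sup>2)" using i2 by auto
    have "x \<le> 1 + x\<^sup>2" for x :: real using sum_squares_bound[of x 1, simplified] zero_le_power2[of x] by linarith
    thus "AE z in circle_measure. norm (cmod (F z)) \<le> norm (1 + (cmod (F z))\<^sup>2)" by auto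
  qed measurable
  have "(LINT z|circle_measure. cmod (F z))\<^sup>2 \<le> (LINT z|circle_measure. (cmod (F z))\<^sup>2)"
    using circle.variance_positive[of "\<lambda>z. cmod (F z)"] circle.variance_eq[OF i1 i2] by simp
  hence "(LINT z|circle_measure. cmod (F z)) \<le> L2_norm (abs_circle_fun F)"
    by (simp add: L2_norm.abs_eq ae_rel_def real_le_rsqrt)
  thus ?thesis
    by (subst nn_integral_eq_integral[OF i1]) (auto intro: ennreal_leI)
qed

text \<open>On a probability space rapid convergence in \<open>L\<^sup>2\<close> makes the sum of the increments integrable,
  hence finite almost everywhere; Fatou then identifies the pointwise limit.\<close>

lemma L2_complete_rapid:
  assumes f: "\<And>n. f n \<in> L2" and rapid: "\<And>n. L2_norm (f (Suc n) - f n) \<le> (1/2) ^ n"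
  shows "\<exists>l\<in>L2. (\<lambda>n. L2_norm (f n - l)) \<longlonglongrightarrow> 0"
proof -
  have "\<forall>n. \<exists>F. F \<in> borel_measurable circle_measure \<and> f n = abs_circle_fun F"
    by (metis circle_fun_representative)
  then obtain F where F [measurable]: "\<And>n. F n \<in> borel_measurable circle_measure"
    and fF: "\<And>n. f n = abs_circle_fun (F n)" by metis
  have diff: "abs_circle_fun F' - abs_circle_fun G' = abs_circle_fun (\<lambda>z. F' z - G' z)"
    if "F' \<in> borel_measurable circle_measure" "G' \<in> borel_measurable circle_measure" for F' G'
    using that by (simp add: minus_circle_fun.abs_eq ae_rel_def)
  \<comment> \<open>Telescoping and the tail of the geometric series: the bound is uniform in
    \<open>k\<close>, so it survives the limit in \<open>k\<close>.\<close>
  have dist: "L2_norm (f (n + k) - f n) \<le> 2 * (1/2) ^ n" for n k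
  proof -
    have "L2_norm (f (n + k) - f n) \<le> (\<Sum>i<k. (1/2) ^ (n + i))"
    proof (induction k)
      case (Suc k)
      have "L2_norm (f (n + Suc k) - f n) \<le> L2_norm (f (Suc (n + k)) - f (n + k)) + L2_norm (f (n + k) - f n)"
        using L2_norm_triangle_diff[OF f f f] by auto
      thus ?case using Suc rapid[of "n + k"] by simp
    qed simp
    also have "\<dots> = (1/2) ^ n * (\<Sum>i<k. (1/2) ^ i)"
      by (simp add: power_add sum_distrib_left)
    also have "(\<Sum>i<k. (1/2::real) ^ i) \<le> 2"
      by (subst geometric_sum) (auto simp: field_simps)
    finally show ?thesis by (simp add: mult.commute)
  qed
  have "(\<integral>\<^sup>+z. (\<Sum>n. ennreal (cmod (F (Suc n) z - F n z))) \<partial>circle_measure) =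
      (\<Sum>n. \<integral>\<^sup>+z. ennreal (cmod (F (Suc n) z - F n z)) \<partial>circle_measure)"
    by (rule nn_integral_suminf) measurable
  also have "\<dots> \<le> (\<Sum>n. ennreal ((1/2) ^ n))"
  proof (intro suminf_le allI)
    fix n
    have "abs_circle_fun (\<lambda>z. F (Suc n) z - F n z) = f (Suc n) - f n"
      using diff[of "F (Suc n)" "F n"] by (simp add: fF)
    thus "(\<integral>\<^sup>+z. ennreal (cmod (F (Suc n) z - F n z)) \<partial>circle_measure) \<le> ennreal ((1/2) ^ n)"
      using nn_integral_le_L2_norm[of "\<lambda>z. F (Suc n) z - F n z"] f rapid[of n]
      by (simp add: L2_diff) (meson ennreal_leI order_trans)
  qed auto
  also have "\<dots> = ennreal (\<Sum>n. (1/2) ^ n)"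
    by (intro suminf_ennreal2) (auto intro: summable_geometric)
  also have "\<dots> < \<infinity>" by simp
  finally have "AE z in circle_measure. (\<Sum>n. ennreal (cmod (F (Suc n) z - F n z))) \<noteq> \<infinity>"
    by (intro nn_integral_PInf_AE) auto
  hence conv: "AE z in circle_measure. (\<lambda>n. F n z) \<longlonglongrightarrow> lim (\<lambda>n. F n z)"
  proof eventually_elim
    case (elim z)
    have "summable (\<lambda>n. cmod (F (Suc n) z - F n z))"
      using elim by (intro summable_suminf_not_top) auto
    hence "summable (\<lambda>n. F (Suc n) z - F n z)" by (rule summable_norm_cancel)
    hence "convergent (\<lambda>n. \<Sum>i<n. F (Suc i) z - F i z)" by (simp add: summable_iff_convergent)
    hence "convergent (\<lambda>n. F n z - F 0 z)"
      by (simp add: sum_lessThan_telescope[of "\<lambda>n. F n z"])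
    hence "convergent (\<lambda>n. (F n z - F 0 z) + F 0 z)"
      by (intro convergent_add convergent_const)
    thus ?case by (simp add: convergent_LIMSEQ_iff)
  qed
  \<comment> \<open>Where the sequence diverges \<open>lim\<close> is unspecified; this concerns a
    null set only.\<close>
  define G where "G z = lim (\<lambda>n. F n z)" for z
  have G [measurable]: "G \<in> borel_measurable circle_measure"
    unfolding G_def by measurable
  have bound: "(\<integral>\<^sup>+z. ennreal ((cmod (F n z - G z))\<^sup>2) \<partial>circle_measure) \<le> ennreal ((2 * (1/2) ^ n)\<^sup>2)" for n
  proof -
    have "(\<integral>\<^sup>+z. ennreal ((cmod (F n z - G z))\<^sup>2) \<partial>circle_measure) =
        (\<integral>\<^sup>+z. liminf (\<lambda>k. ennreal ((cmod (F n z - F (n + k) z))\<^sup>2)) \<partial>circle_measure)"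
    proof (rule nn_integral_cong_AE, use conv in eventually_elim)
      case (elim z)
      have "(\<lambda>k. F (n + k) z) \<longlonglongrightarrow> G z"
        using LIMSEQ_ignore_initial_segment[OF elim, of n] by (simp add: G_def add.commute)
      hence "(\<lambda>k. ennreal ((cmod (F n z - F (n + k) z))\<^sup>2)) \<longlonglongrightarrow> ennreal ((cmod (F n z - G z))\<^sup>2)"
        by (intro tendsto_intros)
      from lim_imp_Liminf[OF trivial_limit_sequentially this] show ?case by simp
    qed
    also have "\<dots> \<le> liminf (\<lambda>k. \<integral>\<^sup>+z. ennreal ((cmod (F n z - F (n + k) z))\<^sup>2) \<partial>circle_measure)"
      by (rule nn_integral_liminf) measurable
    also have "\<dots> \<le> liminf (\<lambda>k::nat. ennreal ((2 * (1/2) ^ n)\<^sup>2))"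
    proof (intro Liminf_mono always_eventually allI)
      fix k
      have e: "abs_circle_fun (\<lambda>z. F n z - F (n + k) z) = f n - f (n + k)"
        using diff[of "F n" "F (n + k)"] by (simp add: fF)
      have "(L2_norm (f n - f (n + k)))\<^sup>2 \<le> (2 * (1/2) ^ n)\<^sup>2"
        using dist[of n k] by (intro power_mono) (auto simp: L2_norm_minus_commute)
      thus "(\<integral>\<^sup>+z. ennreal ((cmod (F n z - F (n + k) z))\<^sup>2) \<partial>circle_measure) \<le> ennreal ((2 * (1/2) ^ n)\<^sup>2)"
        using f nn_integral_L2_norm[of "\<lambda>z. F n z - F (n + k) z"]
        by (simp add: e L2_diff ennreal_leI)
    qed
    finally show ?thesis by (simp add: Liminf_const)
  qed
  define l where "l = abs_circle_fun G"
  have fl: "f n - l \<in> L2" "L2_norm (f n - l) \<le> 2 * (1/2) ^ n" for n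
  proof -
    have e: "f n - l = abs_circle_fun (\<lambda>z. F n z - G z)"
      using diff[of "F n" G] by (simp add: fF l_def)
    show "f n - l \<in> L2" "L2_norm (f n - l) \<le> 2 * (1/2) ^ n"
      unfolding e by (rule L2_I_nn_integral[OF _ bound]; simp)+
  qed
  \<comment> \<open>So far only the differences \<open>f n - l\<close> are known to lie in
    \<open>L2\<close>; \<open>l\<close> is \<open>f 0\<close> minus one of them.\<close>
  have "l \<in> L2" using L2_diff[OF f[of 0] fl(1)[of 0]] by simp
  moreover have "(\<lambda>n. L2_norm (f n - l)) \<longlonglongrightarrow> 0"
  proof (rule tendsto_sandwich[OF _ _ tendsto_const])
    show "(\<lambda>n. 2 * (1/2) ^ n :: real) \<longlonglongrightarrow> 0"
      by (intro tendsto_mult_right_zero LIMSEQ_power_zero) auto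
  qed (use fl in auto)
  ultimately show ?thesis by blast
qed

text \<open>A Cauchy sequence converges as soon as a subsequence does. The indices
  \<open>r n\<close> are chosen so that all later terms stay within (1/2)^n of
  \<open>f (r n)\<close>, which is the rapid convergence required above.\<close>

lemma L2_complete:
  assumes f: "\<And>n. f n \<in> L2"
    and Cauchy: "\<And>e. e > 0 \<Longrightarrow> \<exists>N. \<forall>m\<ge>N. \<forall>n\<ge>N. L2_norm (f m - f n) < e"
  shows "\<exists>l\<in>L2. (\<lambda>n. L2_norm (f n - l)) \<longlonglongrightarrow> 0"
proof -
  have "\<exists>r. strict_mono r \<and> (\<forall>n::nat. \<forall>m\<ge>r n. L2_norm (f m - f (r n)) \<le> (1/2) ^ n)"
  proof -
    have *: "\<exists>k. \<forall>m\<ge>k. L2_norm (f m - f k) \<le> (1/2) ^ n \<and> k > j" for n j :: nat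
    proof -
      obtain N where N: "\<forall>m\<ge>N. \<forall>n'\<ge>N. L2_norm (f m - f n') < (1/2) ^ n"
        using Cauchy[of "(1/2) ^ n"] by auto
      show ?thesis by (rule exI[of _ "max N (Suc j)"]) (use N in \<open>auto intro: less_imp_le\<close>)
    qed
    have "\<exists>r. \<forall>n. (\<forall>m\<ge>r n. L2_norm (f m - f (r n)) \<le> (1/2) ^ n) \<and> r n < r (Suc n)"
      by (rule dependent_nat_choice) (use * in \<open>blast+\<close>)
    thus ?thesis by (auto simp: strict_mono_Suc_iff)
  qed
  then obtain r where r: "strict_mono r" "\<And>n m. m \<ge> r n \<Longrightarrow> L2_norm (f m - f (r n)) \<le> (1/2) ^ n"
    by blast
  have "\<exists>l\<in>L2. (\<lambda>n. L2_norm (f (r n) - l)) \<longlonglongrightarrow> 0"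
    using r(2)[of _ "r (Suc _)"] strict_mono_leD[OF r(1)] f
    by (intro L2_complete_rapid) auto
  then obtain l where l: "l \<in> L2" "(\<lambda>n. L2_norm (f (r n) - l)) \<longlonglongrightarrow> 0" by blast
  have "(\<lambda>n. L2_norm (f n - l)) \<longlonglongrightarrow> 0"
  proof (rule LIMSEQ_I)
    fix e :: real assume e: "e > 0"
    obtain N where N: "\<forall>m\<ge>N. \<forall>n\<ge>N. L2_norm (f m - f n) < e/2"
      using Cauchy[of "e/2"] e by auto
    obtain K where K: "\<forall>n\<ge>K. norm (L2_norm (f (r n) - l) - 0) < e/2"
      using LIMSEQ_D[OF l(2), of "e/2"] e by auto
    define k where "k = r (max N K)"
    have "k \<ge> N" using seq_suble[OF r(1), of "max N K"] by (simp add: k_def)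
    have "norm (L2_norm (f n - l) - 0) < e" if "n \<ge> N" for n
    proof -
      have "L2_norm (f n - l) \<le> L2_norm (f n - f k) + L2_norm (f k - l)"
        using L2_norm_triangle_diff[OF f f l(1)] .
      moreover have "L2_norm (f n - f k) < e/2" using N that \<open>k \<ge> N\<close> by blast
      moreover have "L2_norm (f k - l) < e/2" using K by (simp add: k_def)
      ultimately show ?thesis by simp
    qed
    thus "\<exists>N. \<forall>n\<ge>N. norm (L2_norm (f n - l) - 0) < e" by blast
  qed
  with l(1) show ?thesis by blast
qed

section \<open>Closed subspaces and their orthogonal projections\<close>

definition L2_subspace :: "circle_fun set \<Rightarrow> bool" where
  "L2_subspace S \<longleftrightarrow> S \<subseteq> L2 \<and> 0 \<in> S \<and> (\<forall>f\<in>S. \<forall>h\<in>S. f + h \<in> S) \<and> (\<forall>c. \<forall>f\<in>S. const_fun c * f \<in> S)"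

text \<open>The limit \<open>f\<close> ranges over \<open>L2\<close> because the integral of a
  non-integrable function is 0 by convention, so that \<open>L2_norm\<close> measures nothing
  outside \<open>L2\<close>.\<close>

definition L2_closed :: "circle_fun set \<Rightarrow> bool" where
  "L2_closed S \<longleftrightarrow> (\<forall>f\<in>L2. (\<forall>e>0. \<exists>s\<in>S. L2_norm (f - s) < e) \<longrightarrow> f \<in> S)"

definition L2_dense :: "circle_fun set \<Rightarrow> circle_fun set \<Rightarrow> bool" where
  "L2_dense D S \<longleftrightarrow> D \<subseteq> S \<and> (\<forall>f\<in>S. \<forall>e>0. \<exists>d\<in>D. L2_norm (f - d) < e)"

lemma L2_subspaceD:
  assumes "L2_subspace S"
  shows "f \<in> S \<Longrightarrow> f \<in> L2" "0 \<in> S" "f \<in> S \<Longrightarrow> h \<in> S \<Longrightarrow> f + h \<in> S"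
    "f \<in> S \<Longrightarrow> const_fun c * f \<in> S" "f \<in> S \<Longrightarrow> - f \<in> S" "f \<in> S \<Longrightarrow> h \<in> S \<Longrightarrow> f - h \<in> S"
proof -
  show *: "f \<in> S \<Longrightarrow> f \<in> L2" "0 \<in> S" and add: "\<And>f h. f \<in> S \<Longrightarrow> h \<in> S \<Longrightarrow> f + h \<in> S"
    and const: "\<And>c f. f \<in> S \<Longrightarrow> const_fun c * f \<in> S"
    using assms by (auto simp: L2_subspace_def)
  show um: "f \<in> S \<Longrightarrow> - f \<in> S" for f
    using const[of f "-1"] by (simp add: const_fun_simps)
  show "f \<in> S \<Longrightarrow> h \<in> S \<Longrightarrow> f - h \<in> S"
    using add[of f "- h"] um by simp
qed

lemma L2_subspace_Linf:
  assumes "L2_subspace S"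
  shows "L2_subspace (S \<inter> Linf)"
  using L2_subspaceD[OF assms] const_fun_Linf[of 0]
  by (auto simp: L2_subspace_def const_fun_simps)

text \<open>Approximation arguments bound the distance by a fixed multiple of e; the free factor
  \<open>K\<close> spares them a rescaling.\<close>

lemma L2_eqI:
  assumes "f \<in> L2" "h \<in> L2" "K \<ge> 0" "\<And>e. e > 0 \<Longrightarrow> L2_norm (f - h) \<le> K * e"
  shows "f = h"
proof -
  have "L2_norm (f - h) \<le> 0 + e" if "e > 0" for e
  proof -
    \<comment> \<open>The denominator \<open>K + 1\<close> covers the case
      \<open>K = 0\<close>.\<close>
    have "L2_norm (f - h) \<le> K * (e / (K + 1))" using assms(3) that by (intro assms(4)) simp
    also have "\<dots> \<le> e" using assms(3) that by (simp add: field_simps)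
    finally show ?thesis by simp
  qed
  hence "L2_norm (f - h) \<le> 0" by (rule field_le_epsilon)
  hence "L2_norm (f - h) = 0" using L2_norm_nonneg[of "f - h"] by linarith
  thus ?thesis using assms by (simp add: L2_norm_eq_0 L2_diff)
qed

text \<open>A minimizing sequence is Cauchy by the parallelogram law.\<close>

lemma orthogonal_projection_exists:
  assumes S: "L2_subspace S" "L2_closed S" and f: "f \<in> L2"
  shows "\<exists>p\<in>S. \<forall>h\<in>S. ip (f - p) h = 0"
proof -
  note Sd = L2_subspaceD[OF S(1)]
  define d where "d = (INF s\<in>S. (L2_norm (f - s))\<^sup>2)"
  have bdd: "bdd_below ((\<lambda>s. (L2_norm (f - s))\<^sup>2) ` S)" by (rule bdd_belowI[of _ 0]) auto
  have d_le: "d \<le> (L2_norm (f - s))\<^sup>2" if "s \<in> S" for s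
    unfolding d_def using that bdd by (rule cINF_lower[rotated])
  have "d \<ge> 0" unfolding d_def using Sd(2) by (intro cINF_greatest) auto
  have "\<exists>s\<in>S. (L2_norm (f - s))\<^sup>2 < d + 1 / real (Suc n)" for n
  proof -
    have "d < d + 1 / real (Suc n)" by simp
    thus ?thesis unfolding d_def using cINF_less_iff[OF _ bdd] Sd(2) by blast
  qed
  then obtain s where s: "\<And>n. s n \<in> S" "\<And>n. (L2_norm (f - s n))\<^sup>2 < d + 1 / real (Suc n)"
    by metis
  have sL2: "s n \<in> L2" for n using s Sd(1) by blast
  have Cauchy: "(L2_norm (s m - s n))\<^sup>2 \<le> 2 / real (Suc m) + 2 / real (Suc n)" for m n
  proof -
    \<comment> \<open>The midpoint of two nearly minimal points is in \<open>S\<close>, hence at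
      squared distance at least \<open>d\<close> from \<open>f\<close>. In the parallelogram law the
      terms 4 \<open>d\<close> then cancel and only twice the two excesses remains.\<close>
    define a where "a = const_fun (1/2) * (s m + s n)"
    have "a \<in> S" using s Sd by (simp add: a_def)
    have "const_fun 2 * const_fun (1/2) = 1" by (simp add: const_fun_simps flip: const_fun_simps(4))
    moreover have "const_fun 2 = 1 + 1" using const_fun_simps(3)[of 1 1] by (simp add: const_fun_simps)
    ultimately have "(f - s m) + (f - s n) = const_fun 2 * (f - a)"
      by (simp add: a_def algebra_simps mult.assoc[symmetric])
    hence "(L2_norm ((f - s m) + (f - s n)))\<^sup>2 = 4 * (L2_norm (f - a))\<^sup>2"
      by (simp add: L2_norm_const power_mult_distrib)
    moreover have "4 * d \<le> 4 * (L2_norm (f - a))\<^sup>2" using d_le[OF \<open>a \<in> S\<close>] by simp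
    moreover have "(L2_norm ((f - s m) - (f - s n)))\<^sup>2 = (L2_norm (s m - s n))\<^sup>2"
      using L2_norm_minus_commute[of "s m" "s n"] by simp
    ultimately show ?thesis
      using parallelogram_law[of "f - s m" "f - s n"] s(2)[of m] s(2)[of n] f sL2
      by (simp add: L2_diff)
  qed
  have "\<exists>p\<in>L2. (\<lambda>n. L2_norm (s n - p)) \<longlonglongrightarrow> 0"
  proof (rule L2_complete[OF sL2])
    fix e :: real assume "e > 0"
    obtain N where N: "4 / e\<^sup>2 < real N" using reals_Archimedean2 by blast
    have "L2_norm (s m - s n) < e" if "m \<ge> N" "n \<ge> N" for m n
    proof (rule power2_less_imp_less)
      have "(L2_norm (s m - s n))\<^sup>2 \<le> 2 / real (Suc m) + 2 / real (Suc n)" by (rule Cauchy)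
      also have "\<dots> \<le> 2 / real (Suc N) + 2 / real (Suc N)"
        using that by (intro add_mono divide_left_mono) auto
      also have "\<dots> = 4 / real (Suc N)" by simp
      also have "\<dots> < e\<^sup>2"
      proof -
        have "4 < real N * e\<^sup>2" using N \<open>e > 0\<close> by (simp add: pos_divide_less_eq)
        also have "\<dots> \<le> e\<^sup>2 * real (Suc N)" by (simp add: algebra_simps)
        finally show ?thesis by (simp add: pos_divide_less_eq)
      qed
      finally show "(L2_norm (s m - s n))\<^sup>2 < e\<^sup>2" .
    qed (use \<open>e > 0\<close> in simp)
    thus "\<exists>N. \<forall>m\<ge>N. \<forall>n\<ge>N. L2_norm (s m - s n) < e" by blast
  qed
  then obtain p where p: "p \<in> L2" "(\<lambda>n. L2_norm (s n - p)) \<longlonglongrightarrow> 0" by blast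
  have "p \<in> S"
  proof -
    have "\<exists>a\<in>S. L2_norm (p - a) < e" if "e > 0" for e
      using LIMSEQ_D[OF p(2) that] s(1) L2_norm_minus_commute[of p] by (metis diff_zero le_refl real_norm_def abs_of_nonneg L2_norm_nonneg)
    thus ?thesis using S(2) p(1) by (auto simp: L2_closed_def)
  qed
  have min: "(L2_norm (f - p))\<^sup>2 \<le> d"
  proof -
    have "(\<lambda>n. sqrt (d + 1 / real (Suc n)) + L2_norm (s n - p)) \<longlonglongrightarrow> sqrt (d + 0) + 0"
      by (intro tendsto_intros p(2) LIMSEQ_Suc[OF lim_1_over_n])
    moreover have "L2_norm (f - p) \<le> sqrt (d + 1 / real (Suc n)) + L2_norm (s n - p)" for n
    proof -
      have "L2_norm (f - s n) \<le> sqrt (d + 1 / real (Suc n))"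
        using s(2)[of n] by (intro real_le_rsqrt) simp
      thus ?thesis using L2_norm_triangle_diff[OF f sL2[of n] p(1)] by linarith
    qed
    ultimately have "L2_norm (f - p) \<le> sqrt (d + 0) + 0"
      by (intro LIMSEQ_le_const) auto
    thus ?thesis using \<open>d \<ge> 0\<close> by (metis L2_norm_nonneg add_0_right power_mono real_sqrt_pow2)
  qed
  have "ip (f - p) h = 0" if "h \<in> S" for h
  proof (cases "h = 0")
    case False
    have hL2: "h \<in> L2" and fp: "f - p \<in> L2" using that Sd(1) f p by auto
    define N where "N = (L2_norm h)\<^sup>2"
    have N: "N > 0" using False hL2 L2_norm_nonneg[of h] by (simp add: N_def L2_norm_eq_0 zero_less_power2)
    \<comment> \<open>Moving from \<open>p\<close> by the projection of \<open>f - p\<close> onto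
      the line through \<open>h\<close> lowers the squared distance by
      |\<open>ip (f - p) h\<close>|^2 / \<open>N\<close>; minimality of \<open>p\<close> makes this
      0.\<close>
    define c where "c = ip (f - p) h / of_real N"
    have "p + const_fun c * h \<in> S" using that \<open>p \<in> S\<close> Sd by blast
    from d_le[OF this] have "(L2_norm (f - p))\<^sup>2 \<le> (L2_norm (f - p - const_fun c * h))\<^sup>2"
      using min by (metis diff_diff_eq order_trans)
    also have "\<dots> = (L2_norm (f - p))\<^sup>2 - 2 * Re (cnj c * ip (f - p) h) + (cmod c)\<^sup>2 * N"
      using fp hL2 by (simp add: L2_norm_diff_sq L2_const ip_const_right L2_norm_const power_mult_distrib N_def)
    also have "cnj c * ip (f - p) h = of_real ((cmod (ip (f - p) h))\<^sup>2 / N)"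
      using N by (simp add: c_def complex_norm_square[symmetric] mult.commute flip: of_real_power)
    also have "(cmod c)\<^sup>2 * N = (cmod (ip (f - p) h))\<^sup>2 / N"
      using N by (simp add: c_def norm_divide power_divide power2_eq_square)
    finally have "(cmod (ip (f - p) h))\<^sup>2 / N \<le> 0" by simp
    thus ?thesis using N by (simp add: divide_le_0_iff)
  qed simp
  with \<open>p \<in> S\<close> show ?thesis by blast
qed

text \<open>Uniqueness for the definite description: the difference of two candidates lies in
  \<open>S\<close> and is orthogonal to \<open>S\<close>, hence to itself.\<close>

lemma proj_eqI:
  assumes S: "L2_subspace S" and f: "f \<in> L2" and p: "p \<in> S" "\<And>h. h \<in> S \<Longrightarrow> ip (f - p) h = 0"
  shows "proj S f = p"
  unfolding proj_def
proof (rule the_equality)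
  note Sd = L2_subspaceD[OF S]
  fix q assume q: "q \<in> S \<and> (\<forall>h\<in>S. ip (f - q) h = 0)"
  have L2: "f - p \<in> L2" "f - q \<in> L2" "q - p \<in> L2" and "q - p \<in> S" using f p q Sd by auto
  have "ip (q - p) (q - p) = ip (f - p) (q - p) - ip (f - q) (q - p)"
    using L2 by (subst ip_diff_left[symmetric]) auto
  also have "\<dots> = 0" using p q \<open>q - p \<in> S\<close> by simp
  finally have "q - p = 0" using L2 by (simp add: ip_self L2_norm_eq_0)
  thus "q = p" by simp
qed (use p in auto)

text \<open>Kept apart from closedness because projections arise in two ways: for the model space
  from closedness, for \<open>M\<close> from the explicit formula in
  \<open>projection_formula\<close>.\<close>

definition has_projection :: "circle_fun set \<Rightarrow> bool" where
  "has_projection S \<longleftrightarrow> L2_subspace S \<and> (\<forall>f\<in>L2. \<exists>p\<in>S. \<forall>h\<in>S. ip (f - p) h = 0)"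

lemma closed_has_projection: "L2_subspace S \<Longrightarrow> L2_closed S \<Longrightarrow> has_projection S"
  unfolding has_projection_def using orthogonal_projection_exists by blast

context
  fixes S assumes S: "has_projection S"
begin

lemma proj_props:
  assumes "f \<in> L2"
  shows "proj S f \<in> S" "h \<in> S \<Longrightarrow> ip (f - proj S f) h = 0"
proof -
  obtain p where p: "p \<in> S" "\<And>h. h \<in> S \<Longrightarrow> ip (f - p) h = 0"
    using S assms by (auto simp: has_projection_def)
  hence "proj S f = p" using S assms by (intro proj_eqI) (auto simp: has_projection_def)
  with p show "proj S f \<in> S" "h \<in> S \<Longrightarrow> ip (f - proj S f) h = 0" by auto
qed

lemma proj_add:
  assumes "f \<in> L2" "h \<in> L2"
  shows "proj S (f + h) = proj S f + proj S h"
proof (rule proj_eqI)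
  have sub: "L2_subspace S" using S by (simp add: has_projection_def)
  show "L2_subspace S" by fact
  show "f + h \<in> L2" using assms by auto
  show "proj S f + proj S h \<in> S" using sub assms proj_props by (blast intro: L2_subspaceD)
  fix k assume k: "k \<in> S"
  have "ip (f + h - (proj S f + proj S h)) k = ip ((f - proj S f) + (h - proj S h)) k"
    by (simp add: algebra_simps)
  also have "\<dots> = 0"
    using assms k proj_props L2_subspaceD(1)[OF sub] by (subst ip_add_left) auto
  finally show "ip (f + h - (proj S f + proj S h)) k = 0" .
qed

lemma proj_const:
  assumes "f \<in> L2"
  shows "proj S (const_fun c * f) = const_fun c * proj S f"
proof (rule proj_eqI)
  have sub: "L2_subspace S" using S by (simp add: has_projection_def)
  show "L2_subspace S" by fact
  show "const_fun c * f \<in> L2" using assms by auto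
  show "const_fun c * proj S f \<in> S" using sub assms proj_props by (blast intro: L2_subspaceD)
  fix k assume k: "k \<in> S"
  have "ip (const_fun c * f - const_fun c * proj S f) k = c * ip (f - proj S f) k"
    by (simp add: ip_const_left flip: right_diff_distrib)
  thus "ip (const_fun c * f - const_fun c * proj S f) k = 0" using assms k proj_props by simp
qed

end

subsection \<open>Bounded extensions\<close>

lemma bounded_operator_diff:
  assumes "bounded_operator S B" "L2_subspace S" "f \<in> S" "h \<in> S"
  shows "B (f - h) = B f - B h"
proof -
  note Sd = L2_subspaceD[OF assms(2)]
  have "B (f + const_fun (-1) * h) = B f + const_fun (-1) * B h"
    using assms Sd unfolding bounded_operator_def by metis
  thus ?thesis by (simp add: const_fun_simps)
qed

text \<open>If the operators agree at d, then A f - B f = A (f - d) - B (f - d), which is at most a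
  fixed multiple of the distance from f to d.\<close>

lemma bounded_operator_eq_dense:
  assumes S: "L2_subspace S" and D: "L2_dense D S"
    and A: "bounded_operator S A" and B: "bounded_operator S B"
    and eq: "\<And>f. f \<in> D \<Longrightarrow> A f = B f" and f: "f \<in> S"
  shows "A f = B f"
proof -
  obtain a b where ab: "\<And>f. f \<in> S \<Longrightarrow> L2_norm (A f) \<le> a * L2_norm f" "\<And>f. f \<in> S \<Longrightarrow> L2_norm (B f) \<le> b * L2_norm f"
    using A B unfolding bounded_operator_def by metis
  have in_L2: "A h \<in> L2" "B h \<in> L2" if "h \<in> S" for h
    using A B that L2_subspaceD[OF S] unfolding bounded_operator_def by auto
  show ?thesis
  \<comment> \<open>Absolute values, since \<open>bounded_operator\<close> puts no sign on its
    constant.\<close>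
  proof (rule L2_eqI[of _ _ "\<bar>a\<bar> + \<bar>b\<bar>"])
    fix e :: real assume "e > 0"
    then obtain d where d: "d \<in> D" "d \<in> S" "L2_norm (f - d) < e"
      using D f unfolding L2_dense_def by blast
    have "f - d \<in> S" using d f L2_subspaceD[OF S] by auto
    have "A f - B f = A (f - d) - B (f - d)"
      using eq[OF d(1)] d f by (simp add: bounded_operator_diff[OF A S] bounded_operator_diff[OF B S])
    hence "L2_norm (A f - B f) \<le> L2_norm (A (f - d)) + L2_norm (B (f - d))"
      using L2_norm_triangle[of "A (f - d)" "- B (f - d)"] in_L2[OF \<open>f - d \<in> S\<close>] by auto
    also have "\<dots> \<le> a * L2_norm (f - d) + b * L2_norm (f - d)"
      by (intro add_mono ab \<open>f - d \<in> S\<close>)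
    also have "\<dots> \<le> \<bar>a\<bar> * L2_norm (f - d) + \<bar>b\<bar> * L2_norm (f - d)"
      by (intro add_mono mult_right_mono) auto
    also have "\<dots> = (\<bar>a\<bar> + \<bar>b\<bar>) * L2_norm (f - d)" by (simp add: algebra_simps)
    also have "\<dots> \<le> (\<bar>a\<bar> + \<bar>b\<bar>) * e" using d by (intro mult_left_mono) auto
    finally show "L2_norm (A f - B f) \<le> (\<bar>a\<bar> + \<bar>b\<bar>) * e" .
  qed (use in_L2 f in auto)
qed

text \<open>The value b at f is characterized by the estimate
  \<open>L2_norm (b - T d) \<le> C * L2_norm (f - d)\<close> for all d in \<open>D\<close>. Limits
  are needed only to find b; additivity, homogeneity, the norm bound and agreement with
  \<open>T\<close> all follow from the estimate by choosing d.\<close>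

lemma bounded_extension_exists:
  assumes S: "L2_subspace S" "L2_closed S" and D: "L2_subspace D" "L2_dense D S"
    and T: "\<And>f. f \<in> D \<Longrightarrow> T f \<in> S" "\<And>f h. f \<in> D \<Longrightarrow> h \<in> D \<Longrightarrow> T (f + h) = T f + T h"
      "\<And>c f. f \<in> D \<Longrightarrow> T (const_fun c * f) = const_fun c * T f"
      "\<And>f. f \<in> D \<Longrightarrow> L2_norm (T f) \<le> C0 * L2_norm f"
  shows "\<exists>B. bounded_operator S B \<and> (\<forall>f\<in>D. B f = T f) \<and> (\<forall>f. f \<notin> S \<longrightarrow> B f = 0)"
proof -
  note Sd = L2_subspaceD[OF S(1)] and Dd = L2_subspaceD[OF D(1)]
  have DS: "f \<in> S" if "f \<in> D" for f using that D(2) unfolding L2_dense_def by auto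
  have dense: "\<exists>d\<in>D. L2_norm (f - d) < e" if "f \<in> S" "e > 0" for f e
    using D(2) that unfolding L2_dense_def by auto
  define C where "C = \<bar>C0\<bar>"
  have "C \<ge> 0" by (simp add: C_def)
  have TL2: "T f \<in> L2" if "f \<in> D" for f using T(1) Sd(1) that by blast
  have T0: "T 0 = 0" using T(3)[of 0 0] Dd(2) by (simp add: const_fun_simps)
  have T_diff: "L2_norm (T f - T h) \<le> C * L2_norm (f - h)" if "f \<in> D" "h \<in> D" for f h
  proof -
    have "T (f + const_fun (-1) * h) = T f + const_fun (-1) * T h"
      using that Dd(4) by (simp add: T(2,3))
    hence "T (f - h) = T f - T h" by (simp add: const_fun_simps)
    hence "L2_norm (T f - T h) \<le> C0 * L2_norm (f - h)" using T(4)[OF Dd(6)[OF that]] by simp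
    also have "\<dots> \<le> C * L2_norm (f - h)" unfolding C_def by (intro mult_right_mono) auto
    finally show ?thesis .
  qed
  have "\<exists>b\<in>S. \<forall>d\<in>D. L2_norm (b - T d) \<le> C * L2_norm (f - d)" if f: "f \<in> S" for f
  proof -
    have "\<exists>d\<in>D. L2_norm (f - d) < 1 / real (Suc n)" for n using dense f by simp
    then obtain s where s: "\<And>n. s n \<in> D" "\<And>n. L2_norm (f - s n) < 1 / real (Suc n)" by metis
    have sL2: "s n \<in> L2" "T (s n) \<in> L2" for n using s Dd(1) TL2 by auto
    have fL2: "f \<in> L2" using f Sd by auto
    have s_lim: "(\<lambda>n. L2_norm (s n - f)) \<longlonglongrightarrow> 0"
      by (rule tendsto_sandwich[OF _ _ tendsto_const LIMSEQ_Suc[OF lim_1_over_n]])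
         (use s in \<open>auto simp: L2_norm_minus_commute[of _ f] intro!: always_eventually less_imp_le\<close>)
    have "\<exists>b\<in>L2. (\<lambda>n. L2_norm (T (s n) - b)) \<longlonglongrightarrow> 0"
    proof (rule L2_complete[OF sL2(2)])
      fix e :: real assume "e > 0"
      \<comment> \<open>Two such distances add up to e / (C + 1), and C times this is below e even
        for C = 0.\<close>
      hence "e / (2 * (C + 1)) > 0" using \<open>C \<ge> 0\<close> by simp
      then obtain N where N: "\<And>n. n \<ge> N \<Longrightarrow> L2_norm (s n - f) < e / (2 * (C + 1))"
        using LIMSEQ_D[OF s_lim] by fastforce
      have "L2_norm (T (s m) - T (s n)) < e" if "m \<ge> N" "n \<ge> N" for m n
      proof -
        have half: "e / (2 * (C + 1)) + e / (2 * (C + 1)) = e / (C + 1)"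
          using \<open>C \<ge> 0\<close> by (simp add: divide_simps)
        have "L2_norm (s m - s n) \<le> e / (C + 1)"
          unfolding half[symmetric]
          using L2_norm_triangle_diff[OF sL2(1)[of m] fL2 sL2(1)[of n]]
            add_strict_mono[OF N[OF that(1)] N[OF that(2)]]
          unfolding L2_norm_minus_commute[of f] by (meson less_imp_le order_trans)
        hence "L2_norm (T (s m) - T (s n)) \<le> C * (e / (C + 1))"
          using T_diff[OF s(1)[of m] s(1)[of n]] \<open>C \<ge> 0\<close> mult_left_mono order_trans by blast
        also have "\<dots> < e" using \<open>C \<ge> 0\<close> \<open>e > 0\<close> by (simp add: field_simps)
        finally show ?thesis .
      qed
      thus "\<exists>N. \<forall>m\<ge>N. \<forall>n\<ge>N. L2_norm (T (s m) - T (s n)) < e" by blast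
    qed
    then obtain b where b: "b \<in> L2" "(\<lambda>n. L2_norm (T (s n) - b)) \<longlonglongrightarrow> 0" by blast
    have "\<exists>a\<in>S. L2_norm (b - a) < e" if "e > 0" for e
      using LIMSEQ_D[OF b(2) that] T(1)[OF s(1)] L2_norm_minus_commute[of b]
      by (metis diff_zero le_refl real_norm_def abs_of_nonneg L2_norm_nonneg)
    hence "b \<in> S" using S(2) b(1) by (auto simp: L2_closed_def)
    moreover have "L2_norm (b - T d) \<le> C * L2_norm (f - d)" if d: "d \<in> D" for d
    proof (rule LIMSEQ_le_const)
      have "(\<lambda>n. L2_norm (T (s n) - b) + C * (L2_norm (s n - f) + L2_norm (f - d))) \<longlonglongrightarrow>
              0 + C * (0 + L2_norm (f - d))"
        by (intro tendsto_intros b s_lim)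
      thus "(\<lambda>n. L2_norm (T (s n) - b) + C * (L2_norm (s n - f) + L2_norm (f - d))) \<longlonglongrightarrow> C * L2_norm (f - d)"
        by simp
      have "L2_norm (b - T d) \<le> L2_norm (T (s n) - b) + C * (L2_norm (s n - f) + L2_norm (f - d))" for n
      proof -
        have "L2_norm (b - T d) \<le> L2_norm (T (s n) - b) + L2_norm (T (s n) - T d)"
          using L2_norm_triangle_diff[OF b(1) sL2(2)[of n] TL2[OF d]] by (simp add: L2_norm_minus_commute[of b])
        also have "L2_norm (T (s n) - T d) \<le> C * L2_norm (s n - d)" by (rule T_diff[OF s(1) d])
        also have "L2_norm (s n - d) \<le> L2_norm (s n - f) + L2_norm (f - d)"
          using L2_norm_triangle_diff[OF sL2(1)[of n] fL2 Dd(1)[OF d]] .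
        finally show ?thesis using \<open>C \<ge> 0\<close> by (simp add: mult_left_mono)
      qed
      thus "\<exists>N. \<forall>n\<ge>N. L2_norm (b - T d) \<le> L2_norm (T (s n) - b) + C * (L2_norm (s n - f) + L2_norm (f - d))"
        by blast
    qed
    ultimately show ?thesis by blast
  qed
  then obtain B0 where B0: "\<And>f. f \<in> S \<Longrightarrow> B0 f \<in> S"
    "\<And>f d. f \<in> S \<Longrightarrow> d \<in> D \<Longrightarrow> L2_norm (B0 f - T d) \<le> C * L2_norm (f - d)"
    by metis
  define B where "B f = (if f \<in> S then B0 f else 0)" for f
  have BS: "B f \<in> S" if "f \<in> S" for f using B0 that by (simp add: B_def)
  have BL2: "B f \<in> L2" if "f \<in> S" for f using BS Sd that by auto
  have BT: "L2_norm (B f - T d) \<le> C * L2_norm (f - d)" if "f \<in> S" "d \<in> D" for f d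
    using B0 that by (simp add: B_def)
  have "bounded_operator S B"
    unfolding bounded_operator_def
  proof (intro conjI ballI allI)
    show "B f \<in> S" if "f \<in> S" for f using BS that .
    fix f h assume f: "f \<in> S" and h: "h \<in> S"
    have fh: "f + h \<in> S" using f h Sd by auto
    show "B (f + h) = B f + B h"
    \<comment> \<open>Both \<open>B (f + h)\<close> and \<open>B f + B h\<close> are within 2 C e of
      the common value \<open>T (d + d')\<close>.\<close>
    proof (rule L2_eqI[of _ _ "4 * C"])
      fix e :: real assume "e > 0"
      obtain d d' where d: "d \<in> D" "L2_norm (f - d) < e" and d': "d' \<in> D" "L2_norm (h - d') < e"
        using dense f h \<open>e > 0\<close> by meson
      have L2: "d \<in> L2" "d' \<in> L2" "f \<in> L2" "h \<in> L2" using d d' f h Dd Sd by auto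
      have e: "(B f + B h) - T (d + d') = (B f - T d) + (B h - T d')" "(f + h) - (d + d') = (f - d) + (h - d')"
        using d d' by (simp_all add: T)
      have "L2_norm (B (f + h) - (B f + B h)) \<le> L2_norm (B (f + h) - T (d + d')) + L2_norm ((B f + B h) - T (d + d'))"
        using L2_norm_triangle_diff[OF BL2[OF fh] TL2[OF Dd(3)[OF d(1) d'(1)]] L2_add[OF BL2[OF f] BL2[OF h]]]
        by (simp only: L2_norm_minus_commute[of "T (d + d')"])
      also have "\<dots> \<le> C * (L2_norm (f - d) + L2_norm (h - d')) + (C * L2_norm (f - d) + C * L2_norm (h - d'))"
      proof (rule add_mono)
        have "L2_norm (B (f + h) - T (d + d')) \<le> C * L2_norm (f + h - (d + d'))"
          using BT fh Dd d d' by blast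
        also have "\<dots> \<le> C * (L2_norm (f - d) + L2_norm (h - d'))"
          unfolding e using L2 \<open>C \<ge> 0\<close> by (intro mult_left_mono L2_norm_triangle) auto
        finally show "L2_norm (B (f + h) - T (d + d')) \<le> C * (L2_norm (f - d) + L2_norm (h - d'))" .
        have "L2_norm ((B f + B h) - T (d + d')) \<le> L2_norm (B f - T d) + L2_norm (B h - T d')"
          unfolding e using BL2 TL2 f h d d' by (intro L2_norm_triangle) auto
        also have "\<dots> \<le> C * L2_norm (f - d) + C * L2_norm (h - d')"
          using BT f h d d' by (intro add_mono) auto
        finally show "L2_norm ((B f + B h) - T (d + d')) \<le> C * L2_norm (f - d) + C * L2_norm (h - d')" .
      qed
      also have "\<dots> \<le> C * (e + e) + (C * e + C * e)"
        using d d' \<open>C \<ge> 0\<close> by (intro add_mono mult_left_mono) auto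
      finally show "L2_norm (B (f + h) - (B f + B h)) \<le> 4 * C * e" by (simp add: algebra_simps)
    qed (use \<open>C \<ge> 0\<close> f h fh BL2 in auto)
  next
    fix c f assume f: "f \<in> S"
    have cf: "const_fun c * f \<in> S" using f Sd by auto
    show "B (const_fun c * f) = const_fun c * B f"
    proof (rule L2_eqI[of _ _ "2 * cmod c * C"])
      fix e :: real assume "e > 0"
      obtain d where d: "d \<in> D" "L2_norm (f - d) < e"
        using dense f \<open>e > 0\<close> by meson
      have cd: "const_fun c * d \<in> D" using d Dd by auto
      have "L2_norm (B (const_fun c * f) - const_fun c * B f) \<le>
          L2_norm (B (const_fun c * f) - T (const_fun c * d)) + L2_norm (T (const_fun c * d) - const_fun c * B f)"
        using cf cd f BL2 TL2 by (intro L2_norm_triangle_diff) auto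
      also have "T (const_fun c * d) - const_fun c * B f = const_fun c * (T d - B f)"
        using d by (simp add: T right_diff_distrib)
      also have "L2_norm \<dots> = cmod c * L2_norm (B f - T d)"
        by (simp add: L2_norm_const L2_norm_minus_commute)
      also have "\<dots> \<le> cmod c * (C * L2_norm (f - d))" using BT f d by (intro mult_left_mono) auto
      also have "L2_norm (B (const_fun c * f) - T (const_fun c * d)) \<le> C * L2_norm (const_fun c * f - const_fun c * d)"
        using BT cf cd by blast
      also have "\<dots> = cmod c * (C * L2_norm (f - d))"
        by (simp add: L2_norm_const flip: right_diff_distrib)
      also have "cmod c * (C * L2_norm (f - d)) \<le> cmod c * (C * e)"
        using d \<open>C \<ge> 0\<close> by (intro mult_left_mono) auto
      finally show "L2_norm (B (const_fun c * f) - const_fun c * B f) \<le> 2 * cmod c * C * e"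
        by (simp add: algebra_simps)
    qed (use \<open>C \<ge> 0\<close> f cf BL2 in auto)
  next
    \<comment> \<open>The choice d = 0, where \<open>T\<close> vanishes, turns the estimate into the
      operator bound.\<close>
    have "\<forall>f\<in>S. L2_norm (B f) \<le> C * L2_norm f" using BT[OF _ Dd(2)] by (simp add: T0)
    thus "\<exists>C. \<forall>f\<in>S. L2_norm (B f) \<le> C * L2_norm f" ..
  qed
  \<comment> \<open>The choice d = f makes the right-hand side of the estimate 0.\<close>
  moreover have "B f = T f" if "f \<in> D" for f
    using BT[OF DS[OF that] that] that DS BL2 TL2 by (intro L2_eqI[of _ _ 0]) auto
  ultimately show ?thesis by (intro exI[of _ B]) (auto simp: B_def)
qed

text \<open>Density settles the values on \<open>S\<close> and the convention 0 those outside. So a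
  bounded operator obtained by any construction can be recognized as the compression.\<close>

lemma compression_eqI:
  assumes S: "L2_subspace S" and D: "L2_dense (S \<inter> Linf) S" and B: "bounded_operator S B"
    and "\<And>f. f \<in> S \<inter> Linf \<Longrightarrow> B f = proj S (g * f)" "\<And>f. f \<notin> S \<Longrightarrow> B f = 0"
  shows "compression S g = B"
  unfolding compression_def
proof (rule the_equality)
  fix B' assume B': "bounded_operator S B' \<and> (\<forall>f\<in>S \<inter> Linf. B' f = proj S (g * f)) \<and> (\<forall>f. f \<notin> S \<longrightarrow> B' f = 0)"
  have "B' f = B f" for f
    using bounded_operator_eq_dense[OF S D, of B' B f] B B' assms by (cases "f \<in> S") auto
  thus "B' = B" by auto
qed (use assms in auto)

lemma compression_props:
  assumes S: "L2_subspace S" "L2_closed S" and D: "L2_dense (S \<inter> Linf) S" and g: "g \<in> L2"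
    and bdd: "bounded_compression S g"
  shows "bounded_operator S (compression S g)" "f \<in> S \<inter> Linf \<Longrightarrow> compression S g f = proj S (g * f)"
proof -
  have pr: "has_projection S" using S by (rule closed_has_projection)
  have gL2: "g * f \<in> L2" if "f \<in> Linf" for f using Linf_times_L2[OF that g] by (simp add: mult.commute)
  obtain C where C: "\<forall>f\<in>S \<inter> Linf. L2_norm (proj S (g * f)) \<le> C * L2_norm f"
    using bdd by (auto simp: bounded_compression_def)
  have "\<exists>B. bounded_operator S B \<and> (\<forall>f\<in>S \<inter> Linf. B f = proj S (g * f)) \<and> (\<forall>f. f \<notin> S \<longrightarrow> B f = 0)"
  proof (rule bounded_extension_exists[OF S L2_subspace_Linf[OF S(1)] D])
    show "proj S (g * f) \<in> S" if "f \<in> S \<inter> Linf" for f using proj_props(1)[OF pr] gL2 that by blast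
    show "proj S (g * (f + h)) = proj S (g * f) + proj S (g * h)" if "f \<in> S \<inter> Linf" "h \<in> S \<inter> Linf" for f h
      using that proj_add[OF pr gL2 gL2] by (simp add: distrib_left)
    show "proj S (g * (const_fun c * f)) = const_fun c * proj S (g * f)" if "f \<in> S \<inter> Linf" for c f
      using that proj_const[OF pr gL2] by (simp add: mult.left_commute)
    show "L2_norm (proj S (g * f)) \<le> C * L2_norm f" if "f \<in> S \<inter> Linf" for f using C that by blast
  qed
  then obtain B where B: "bounded_operator S B" "\<And>f. f \<in> S \<inter> Linf \<Longrightarrow> B f = proj S (g * f)" "\<And>f. f \<notin> S \<Longrightarrow> B f = 0"
    by blast
  have "compression S g = B" using compression_eqI[OF S(1) D B] .
  with B show "bounded_operator S (compression S g)" "f \<in> S \<inter> Linf \<Longrightarrow> compression S g f = proj S (g * f)"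
    by auto
qed

subsection \<open>Analytic polynomials and the Hardy space\<close>

lemma sets_circle_measure: "sets circle_measure = sets (restrict_space borel (sphere 0 1))"
  by (simp add: circle_measure_def)

lemma measurable_circle_continuous:
  fixes F :: "complex \<Rightarrow> complex"
  assumes "continuous_on (sphere 0 1) F"
  shows "F \<in> borel_measurable circle_measure"
  using borel_measurable_continuous_on_restrict[OF assms]
  by (simp cong: measurable_cong_sets add: measurable_cong_sets[OF sets_circle_measure refl])

lemma measurable_circle_poly [measurable]: "poly p \<in> borel_measurable circle_measure"
  by (intro measurable_circle_continuous continuous_intros)

text \<open>Moves integrals of continuous functions to an interval, where the fundamental theorem of
  calculus applies.\<close>

lemma integral_circle_measure:
  fixes F :: "complex \<Rightarrow> complex"
  assumes F: "continuous_on (sphere 0 1) F"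
  shows "(LINT z|circle_measure. F z) =
    (LINT t|lborel. indicator {0..2 * pi} t *\<^sub>R F (cis t)) / of_real (2 * pi)"
proof -
  let ?I = "{0..2 * pi :: real}"
  have Fm: "F \<in> borel_measurable (restrict_space borel (sphere 0 1))"
    using F by (rule borel_measurable_continuous_on_restrict)
  have cis: "cis \<in> borel \<rightarrow>\<^sub>M restrict_space borel (sphere 0 1)"
    by (intro measurable_restrict_space2 borel_measurable_continuous_onI)
       (auto intro!: continuous_intros simp: cis_conv_exp)
  have m: "cis \<in> uniform_measure lborel ?I \<rightarrow>\<^sub>M restrict_space borel (sphere 0 1)"
    using cis by (simp cong: measurable_cong_sets)
  have m': "(\<lambda>t. F (cis t)) \<in> borel_measurable lborel"
    using measurable_compose[OF cis Fm] by simp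
  have u: "uniform_measure lborel ?I = density lborel (\<lambda>t. ennreal (indicator ?I t / (2 * pi)))"
    unfolding uniform_measure_def
    by (intro arg_cong[where f = "density lborel"] ext) (simp add: indicator_def divide_ennreal[symmetric])
  have "(LINT z|circle_measure. F z) = (LINT t|uniform_measure lborel ?I. F (cis t))"
    unfolding circle_measure_def by (rule integral_distr[OF m Fm])
  also have "\<dots> = (LINT t|lborel. (indicator ?I t / (2 * pi)) *\<^sub>R F (cis t))"
    unfolding u by (intro integral_density m') auto
  also have "\<dots> = (LINT t|lborel. (indicator ?I t *\<^sub>R F (cis t)) / of_real (2 * pi))"
    by (intro Bochner_Integration.integral_cong refl) (simp add: indicator_def scaleR_conv_of_real)
  also have "\<dots> = (LINT t|lborel. indicator {0..2 * pi} t *\<^sub>R F (cis t)) / of_real (2 * pi)"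
    by (rule integral_divide_zero)
  finally show ?thesis .
qed

lemma integral_circle_monomials:
  "(LINT z|circle_measure. z ^ m * cnj (z ^ n)) = (if m = n then 1 else 0)"
proof (cases "m = n")
  case True
  have "(LINT z|circle_measure. z ^ m * cnj (z ^ n)) = (LINT z|circle_measure. 1)"
    by (intro Bochner_Integration.integral_cong refl)
       (simp add: True complex_norm_square[symmetric] norm_power del: complex_cnj_power)
  also have "\<dots> = 1" using circle.prob_space by simp
  finally show ?thesis using True by simp
next
  case False
  \<comment> \<open>The frequency is a real difference, as subtraction of natural numbers would
    truncate. It is an integer, so the antiderivative cis (k t) / (i k) has equal values at both
    ends.\<close>
  define k where "k = real m - real n"
  have k: "k \<noteq> 0" using False by (simp add: k_def)
  have "(LINT z|circle_measure. z ^ m * cnj (z ^ n)) =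
     (LINT t|lborel. indicator {0..2 * pi} t *\<^sub>R (cis t ^ m * cnj (cis t ^ n))) / of_real (2 * pi)"
    by (intro integral_circle_measure continuous_intros)
  also have "(\<lambda>t. cis t ^ m * cnj (cis t ^ n)) = (\<lambda>t. cis (k * t))"
    unfolding complex_cnj_power cis_cnj Complex.DeMoivre cis_mult by (simp add: k_def algebra_simps)
  also have "(LINT t|lborel. indicator {0..2 * pi} t *\<^sub>R cis (k * t)) =
      cis (k * (2 * pi)) / (\<i> * of_real k) - cis (k * 0) / (\<i> * of_real k)"
  proof (rule integral_FTC_Icc)
    have "((\<lambda>w. exp (\<i> * of_real k * w) / (\<i> * of_real k)) has_field_derivative exp (\<i> * of_real k * w)) (at w)" for w
      using k by (auto intro!: derivative_eq_intros)
    from has_vector_derivative_real_field[OF this]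
    show "((\<lambda>t. cis (k * t) / (\<i> * of_real k)) has_vector_derivative cis (k * t)) (at t within {0..2 * pi})" for t
      by (simp add: cis_conv_exp mult.assoc)
    show "continuous_on {0..2 * pi} (\<lambda>t. cis (k * t))"
      by (auto intro!: continuous_intros simp: cis_conv_exp)
  qed auto
  also have "k * (2 * pi) = 2 * pi * of_int (int m - int n)" by (simp add: k_def)
  also have "cis (2 * pi * of_int (int m - int n)) = 1" by (rule cis_multiple_2pi) auto
  finally show ?thesis using False by simp
qed

text \<open>With formal polynomials as index the Fourier coefficients become \<open>coeff\<close>,
  and products and dilates become polynomial operations.\<close>

lift_definition pfun :: "complex poly \<Rightarrow> circle_fun" is "\<lambda>p z. poly p z"
  by (simp add: ae_rel_def)

lemma pfun_eq_abs: "pfun p = abs_circle_fun (poly p)"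
  by (simp add: pfun.abs_eq)

lemma pfun_add: "pfun (p + q) = pfun p + pfun q"
  by transfer (simp add: ae_rel_def)

lemma pfun_diff: "pfun (p - q) = pfun p - pfun q"
  by transfer (simp add: ae_rel_def)

lemma pfun_mult: "pfun (p * q) = pfun p * pfun q"
  by transfer (simp add: ae_rel_def)

lemma pfun_smult: "pfun (smult c p) = const_fun c * pfun p"
  by transfer (simp add: ae_rel_def)

lemma pfun_0 [simp]: "pfun 0 = 0"
  by transfer (simp add: ae_rel_def)

lemma pfun_Linf [simp]: "pfun p \<in> Linf"
  unfolding Linf_def mem_Collect_eq
proof transfer
  fix p :: "complex poly"
  have "compact (poly p ` sphere 0 1)"
    by (intro compact_continuous_image continuous_intros) auto
  then obtain C where "\<forall>w\<in>poly p ` sphere 0 1. cmod w \<le> C"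
    using compact_imp_bounded bounded_iff by blast
  thus "\<exists>C. AE z in circle_measure. cmod (poly p z) \<le> C"
    by (intro exI[of _ C] AE_I2) auto
qed

lemma pfun_L2 [simp]: "pfun p \<in> L2"
  by (simp add: Linf_subset_L2)

lemma pfun_sum: "finite A \<Longrightarrow> pfun (\<Sum>i\<in>A. p i) = (\<Sum>i\<in>A. pfun (p i))"
  by (induction rule: finite_induct) (auto simp: pfun_add)

lemma L2_sum: "finite A \<Longrightarrow> (\<And>i. i \<in> A \<Longrightarrow> f i \<in> L2) \<Longrightarrow> (\<Sum>i\<in>A. f i) \<in> L2"
  by (induction rule: finite_induct) auto

lemma ip_sum_left:
  "finite A \<Longrightarrow> (\<And>i. i \<in> A \<Longrightarrow> f i \<in> L2) \<Longrightarrow> h \<in> L2 \<Longrightarrow> ip (\<Sum>i\<in>A. f i) h = (\<Sum>i\<in>A. ip (f i) h)"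
  by (induction rule: finite_induct) (auto simp: ip_add_left L2_sum)

lemma ip_sum_right:
  "finite A \<Longrightarrow> (\<And>i. i \<in> A \<Longrightarrow> f i \<in> L2) \<Longrightarrow> h \<in> L2 \<Longrightarrow> ip h (\<Sum>i\<in>A. f i) = (\<Sum>i\<in>A. ip h (f i))"
  by (induction rule: finite_induct) (auto simp: ip_add_right L2_sum)

section \<open>Orthonormality of the monomials, Parseval and Bessel\<close>

definition zpow :: "nat \<Rightarrow> circle_fun" where "zpow n = pfun (monom 1 n)"

lemma zpow_L2 [simp]: "zpow n \<in> L2" and zpow_Linf [simp]: "zpow n \<in> Linf"
  by (simp_all add: zpow_def)

lemma ip_zpow: "ip (zpow m) (zpow n) = (if m = n then 1 else 0)"
  unfolding zpow_def by transfer (simp add: poly_monom integral_circle_monomials del: complex_cnj_power)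

lemma L2_norm_zpow [simp]: "L2_norm (zpow n) = 1"
  using L2_norm_eq[of "zpow n"] L2_norm_nonneg[of "zpow n"] by (simp add: ip_zpow power2_eq_1_iff)

lemma pfun_expand:
  assumes "degree p \<le> N"
  shows "pfun p = (\<Sum>i\<le>N. const_fun (coeff p i) * zpow i)"
proof -
  have "p = (\<Sum>i\<le>N. smult (coeff p i) (monom 1 i))"
    using poly_as_sum_of_monoms'[OF assms] by (simp add: smult_monom)
  hence "pfun p = pfun (\<Sum>i\<le>N. smult (coeff p i) (monom 1 i))" by simp
  thus ?thesis by (simp add: pfun_sum pfun_smult zpow_def)
qed

lemma ip_pfun_zpow: "ip (pfun p) (zpow n) = coeff p n"
proof -
  have "ip (pfun p) (zpow n) = (\<Sum>i\<le>degree p. ip (const_fun (coeff p i) * zpow i) (zpow n))"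
    by (subst pfun_expand[OF order_refl], rule ip_sum_left) auto
  also have "\<dots> = (\<Sum>i\<le>degree p. if i = n then coeff p i else 0)"
    by (intro sum.cong) (auto simp: ip_const_left ip_zpow)
  also have "\<dots> = coeff p n" by (auto simp: coeff_eq_0)
  finally show ?thesis .
qed

lemma ip_pfun_right:
  assumes "f \<in> L2" "degree p \<le> N"
  shows "ip f (pfun p) = (\<Sum>i\<le>N. cnj (coeff p i) * ip f (zpow i))"
proof -
  have "ip f (pfun p) = (\<Sum>i\<le>N. ip f (const_fun (coeff p i) * zpow i))"
    using assms by (subst pfun_expand[OF assms(2)], intro ip_sum_right) auto
  thus ?thesis by (simp add: ip_const_right)
qed

text \<open>Parseval for polynomials. The free bound \<open>N\<close> avoids exact degrees, which
  drop for truncated series with vanishing coefficients.\<close>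

lemma L2_norm_pfun:
  assumes "degree p \<le> N"
  shows "(L2_norm (pfun p))\<^sup>2 = (\<Sum>i\<le>N. (cmod (coeff p i))\<^sup>2)"
proof -
  have "of_real ((L2_norm (pfun p))\<^sup>2) = (\<Sum>i\<le>N. complex_of_real ((cmod (coeff p i))\<^sup>2))"
    unfolding ip_self[symmetric]
    by (subst ip_pfun_right[OF pfun_L2 assms]) (simp add: ip_pfun_zpow complex_norm_square mult.commute del: of_real_power)
  also have "\<dots> = of_real (\<Sum>i\<le>N. (cmod (coeff p i))\<^sup>2)" by simp
  finally show ?thesis using of_real_eq_iff by blast
qed

text \<open>For the partial Fourier sum p of f, both the inner product of f with p and the squared
  norm of p equal the left-hand side, so the squared norm of f - p is the difference of the two
  sides.\<close>

lemma Bessel: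
  assumes f: "f \<in> L2"
  shows "(\<Sum>i\<le>N. (cmod (ip f (zpow i)))\<^sup>2) \<le> (L2_norm f)\<^sup>2"
proof -
  define p where "p = (\<Sum>i\<le>N. monom (ip f (zpow i)) i)"
  have c: "coeff p i = (if i \<le> N then ip f (zpow i) else 0)" for i
    by (simp add: p_def coeff_sum coeff_monom)
  have d: "degree p \<le> N" by (rule degree_le) (simp add: c)
  have "complex_of_real (Re (ip f (pfun p))) = (\<Sum>i\<le>N. complex_of_real ((cmod (ip f (zpow i)))\<^sup>2))"
    by (subst ip_pfun_right[OF f d]) (simp add: c complex_norm_square[symmetric] mult.commute flip: of_real_power of_real_sum)
  also have "\<dots> = of_real (\<Sum>i\<le>N. (cmod (ip f (zpow i)))\<^sup>2)" by simp
  finally have "Re (ip f (pfun p)) = (\<Sum>i\<le>N. (cmod (ip f (zpow i)))\<^sup>2)" using of_real_eq_iff by blast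
  moreover have "(L2_norm (pfun p))\<^sup>2 = (\<Sum>i\<le>N. (cmod (ip f (zpow i)))\<^sup>2)"
    by (simp add: L2_norm_pfun[OF d] c)
  ultimately show ?thesis
    using L2_norm_diff_sq[OF f pfun_L2[of p]] zero_le_power2[of "L2_norm (f - pfun p)"] by linarith
qed

text \<open>Convergence at every point of the open disc forces a radius of convergence of at least
  1, and a power series converges uniformly on smaller closed discs.\<close>

lemma uniform_partial_sums:
  fixes a :: "nat \<Rightarrow> complex"
  assumes sums: "\<And>w. cmod w < 1 \<Longrightarrow> (\<lambda>n. a n * w ^ n) sums F w"
    and r: "0 \<le> r" "r < 1" and e: "e > 0"
  obtains N where "\<And>w. cmod w \<le> r \<Longrightarrow> cmod (F w - (\<Sum>i<N. a i * w ^ i)) < e"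
proof -
  have "1 \<le> conv_radius a"
  proof (rule conv_radius_geI_ex')
    fix r :: real assume "0 < r" "ereal r < 1"
    thus "summable (\<lambda>n. a n * of_real r ^ n)" using sums[of "of_real r"] by (auto simp: sums_iff)
  qed
  moreover have "ereal r < 1" using r by simp
  ultimately have "ereal r < conv_radius a" by (rule order.strict_trans2[rotated])
  from powser_uniform_limit[OF this, of 0]
  have "\<forall>\<^sub>F n in sequentially. \<forall>x\<in>cball 0 r. dist (\<Sum>i<n. a i * (x - 0) ^ i) (suminf (\<lambda>i. a i * (x - 0) ^ i)) < e"
    using e unfolding uniform_limit_iff by blast
  then obtain N where N: "\<forall>x\<in>cball 0 r. dist (\<Sum>i<N. a i * (x - 0) ^ i) (suminf (\<lambda>i. a i * (x - 0) ^ i)) < e"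
    using eventually_happens'[OF sequentially_bot] by blast
  show ?thesis
  proof (rule that[of N])
    fix w assume w: "cmod w \<le> r"
    hence "suminf (\<lambda>i. a i * w ^ i) = F w" using sums[of w] r by (simp add: sums_iff)
    thus "cmod (F w - (\<Sum>i<N. a i * w ^ i)) < e"
      using N[rule_format, of w] w by (simp add: dist_norm norm_minus_commute)
  qed
qed

section \<open>Dilates, Taylor series and boundary values\<close>

lemma measurable_dilate:
  assumes "F holomorphic_on ball 0 1" "0 \<le> r" "r < 1"
  shows "(\<lambda>z. F (of_real r * z)) \<in> borel_measurable circle_measure"
proof (rule measurable_circle_continuous, rule continuous_on_compose2[of "ball 0 1" F])
  show "continuous_on (ball 0 1) F" using assms by (intro holomorphic_on_imp_continuous_on)
qed (use assms in \<open>auto intro!: continuous_intros simp: norm_mult\<close>)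

lemma two_ennreal: "2 * ennreal x = ennreal (2 * x)"
  by (simp add: ennreal_mult')

text \<open>A triangle inequality for squared distances, at the price of the factor 2. It needs no
  square roots of extended values and no integrability.\<close>

lemma nn_integral_sq_triangle:
  assumes [measurable]: "A \<in> borel_measurable circle_measure" "B \<in> borel_measurable circle_measure"
    "C \<in> borel_measurable circle_measure"
  shows "(\<integral>\<^sup>+z. ennreal ((cmod (A z - C z))\<^sup>2) \<partial>circle_measure) \<le>
     2 * (\<integral>\<^sup>+z. ennreal ((cmod (A z - B z))\<^sup>2) \<partial>circle_measure) +
     2 * (\<integral>\<^sup>+z. ennreal ((cmod (B z - C z))\<^sup>2) \<partial>circle_measure)"
proof -
  have "(cmod (A z - C z))\<^sup>2 \<le> 2 * (cmod (A z - B z))\<^sup>2 + 2 * (cmod (B z - C z))\<^sup>2" for z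
    using power_mono[OF norm_triangle_ineq[of "A z - B z" "B z - C z"], of 2]
      sum_squares_bound[of "cmod (A z - B z)" "cmod (B z - C z)"]
    by (simp add: power2_sum)
  hence "(\<integral>\<^sup>+z. ennreal ((cmod (A z - C z))\<^sup>2) \<partial>circle_measure) \<le>
      (\<integral>\<^sup>+z. 2 * ennreal ((cmod (A z - B z))\<^sup>2) + 2 * ennreal ((cmod (B z - C z))\<^sup>2) \<partial>circle_measure)"
    by (intro nn_integral_mono) (simp add: ennreal_mult'[symmetric] ennreal_plus[symmetric] del: ennreal_plus flip: ennreal_numeral)
  also have "\<dots> = 2 * (\<integral>\<^sup>+z. ennreal ((cmod (A z - B z))\<^sup>2) \<partial>circle_measure) +
     2 * (\<integral>\<^sup>+z. ennreal ((cmod (B z - C z))\<^sup>2) \<partial>circle_measure)"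
    by (simp add: nn_integral_add nn_integral_cmult)
  finally show ?thesis .
qed

text \<open>A dilate of F is close to f in \<open>L2\<close>, and a Taylor polynomial is uniformly
  close to the dilate, whose arguments stay in a smaller disc. As only holomorphy enters, this
  serves \<open>H2\<close> and \<open>Hinf\<close> alike.\<close>

lemma boundary_value_approx:
  assumes hol: "F holomorphic_on ball 0 1" and bv: "boundary_value F f" and e: "e > 0"
  shows "\<exists>p. L2_norm (f - pfun p) < e"
proof -
  obtain G where G [measurable]: "G \<in> borel_measurable circle_measure" and fG: "f = abs_circle_fun G"
    by (rule circle_fun_representative)
  have "((\<lambda>r::real. \<integral>\<^sup>+z. ennreal ((cmod (F (of_real r * z) - G z))\<^sup>2) \<partial>circle_measure) \<longlongrightarrow> 0) (at_left 1)"
    using bv by (simp add: fG boundary_value.abs_eq ae_rel_def)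
  \<comment> \<open>Together with the uniform error e/4 below, the doubled squares add up to 3 e^2 /
    8, which is less than (3 e / 4)^2.\<close>
  hence "eventually (\<lambda>r::real. (\<integral>\<^sup>+z. ennreal ((cmod (F (of_real r * z) - G z))\<^sup>2) \<partial>circle_measure) < ennreal (e\<^sup>2 / 8)) (at_left 1)"
    using e by (intro order_tendstoD) auto
  moreover have "eventually (\<lambda>r::real. r \<in> {0<..<1}) (at_left 1)"
    by (rule eventually_at_left_real) simp
  ultimately have "eventually (\<lambda>r::real. (\<integral>\<^sup>+z. ennreal ((cmod (F (of_real r * z) - G z))\<^sup>2) \<partial>circle_measure) < ennreal (e\<^sup>2 / 8) \<and> r \<in> {0<..<1}) (at_left 1)"
    by (rule eventually_conj)
  then obtain r :: real where r: "0 < r" "r < 1"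
      "(\<integral>\<^sup>+z. ennreal ((cmod (F (of_real r * z) - G z))\<^sup>2) \<partial>circle_measure) < ennreal (e\<^sup>2 / 8)"
    using eventually_happens'[of "at_left (1::real)"] by auto
  define a where "a n = (deriv ^^ n) F 0 / fact n" for n
  have sums: "(\<lambda>n. a n * w ^ n) sums F w" if "cmod w < 1" for w
    using holomorphic_power_series[OF hol, of w] that by (simp add: a_def)
  obtain N where N: "\<And>w. cmod w \<le> r \<Longrightarrow> cmod (F w - (\<Sum>i<N. a i * w ^ i)) < e / 4"
    using uniform_partial_sums[OF sums, of r "e/4"] r e by auto
  define p where "p = (\<Sum>i<N. monom (a i * of_real r ^ i) i)"
  have p: "poly p z = (\<Sum>i<N. a i * (of_real r * z) ^ i)" for z
    by (simp add: p_def poly_sum poly_monom power_mult_distrib mult.assoc)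
  have Fr [measurable]: "(\<lambda>z. F (of_real r * z)) \<in> borel_measurable circle_measure"
    using measurable_dilate[OF hol] r by auto
  have "(\<integral>\<^sup>+z. ennreal ((cmod (F (of_real r * z) - poly p z))\<^sup>2) \<partial>circle_measure) \<le>
      (\<integral>\<^sup>+z. ennreal ((e/4)\<^sup>2) \<partial>circle_measure)"
  proof (intro nn_integral_mono ennreal_leI power_mono)
    fix z assume "z \<in> space circle_measure"
    thus "cmod (F (of_real r * z) - poly p z) \<le> e / 4"
      using N[of "of_real r * z"] r by (simp add: p norm_mult)
  qed auto
  also have "\<dots> = ennreal ((e/4)\<^sup>2)" using circle.emeasure_space_1 by simp
  finally have b2: "(\<integral>\<^sup>+z. ennreal ((cmod (F (of_real r * z) - poly p z))\<^sup>2) \<partial>circle_measure) \<le> ennreal ((e/4)\<^sup>2)" .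
  have b1: "(\<integral>\<^sup>+z. ennreal ((cmod (G z - F (of_real r * z)))\<^sup>2) \<partial>circle_measure) \<le> ennreal (e\<^sup>2 / 8)"
    using r(3) by (simp add: norm_minus_commute)
  have "(\<integral>\<^sup>+z. ennreal ((cmod (G z - poly p z))\<^sup>2) \<partial>circle_measure) \<le> 2 * ennreal (e\<^sup>2 / 8) + 2 * ennreal ((e/4)\<^sup>2)"
    by (rule order_trans[OF nn_integral_sq_triangle[OF G Fr measurable_circle_poly]])
       (intro add_mono mult_left_mono b1 b2 zero_le)
  also have "\<dots> = ennreal (2 * (e\<^sup>2 / 8) + 2 * (e/4)\<^sup>2)"
    unfolding two_ennreal by (intro ennreal_plus[symmetric]) auto
  also have "\<dots> \<le> ennreal ((3 * e / 4)\<^sup>2)"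
    by (intro ennreal_leI) (simp add: power_divide power_mult_distrib field_simps)
  finally have "L2_norm (abs_circle_fun (\<lambda>z. G z - poly p z)) \<le> 3 * e / 4"
    using e by (intro L2_I_nn_integral(2)) auto
  moreover have "abs_circle_fun (\<lambda>z. G z - poly p z) = f - pfun p"
    by (simp add: fG pfun_eq_abs minus_circle_fun.abs_eq ae_rel_def)
  ultimately show ?thesis using e by (intro exI[of _ p]) auto
qed

text \<open>For f in \<open>H2\<close> this is the holomorphic extension to the disc; for other f in
  \<open>L2\<close> it extends the analytic part of f.\<close>

definition taylor_sum :: "circle_fun \<Rightarrow> complex \<Rightarrow> complex" where
  "taylor_sum f w = (\<Sum>n. ip f (zpow n) * w ^ n)"

lemma taylor_sums:
  assumes f: "f \<in> L2" and w: "cmod w < 1"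
  shows "(\<lambda>n. ip f (zpow n) * w ^ n) sums taylor_sum f w"
  unfolding taylor_sum_def
proof (rule summable_sums, rule summable_comparison_test')
  show "summable (\<lambda>n. L2_norm f * cmod w ^ n)"
    using w by (intro summable_mult summable_geometric) simp
  show "norm (ip f (zpow n) * w ^ n) \<le> L2_norm f * cmod w ^ n" for n
    using Cauchy_Schwarz_L2[OF f zpow_L2[of n]] by (simp add: norm_mult norm_power mult_right_mono)
qed

lemma taylor_sum_holomorphic: "f \<in> L2 \<Longrightarrow> taylor_sum f holomorphic_on ball 0 1"
  using taylor_sums by (intro power_series_holomorphic[where a = "\<lambda>n. ip f (zpow n)"]) auto

lemma taylor_sum_diff_pfun:
  assumes f: "f \<in> L2" and w: "cmod w < 1"
  shows "taylor_sum (f - pfun p) w = taylor_sum f w - poly p w"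
proof -
  have "(\<lambda>n. coeff p n * w ^ n) sums (\<Sum>n\<le>degree p. coeff p n * w ^ n)"
    by (rule sums_finite) (auto simp: coeff_eq_0)
  hence "(\<lambda>n. ip f (zpow n) * w ^ n - coeff p n * w ^ n) sums (taylor_sum f w - poly p w)"
    using taylor_sums[OF f w] by (intro sums_diff) (simp_all add: poly_altdef)
  moreover have "ip f (zpow n) * w ^ n - coeff p n * w ^ n = ip (f - pfun p) (zpow n) * w ^ n" for n
    using f by (simp add: ip_diff_left ip_pfun_zpow left_diff_distrib)
  ultimately show ?thesis
    using taylor_sums[OF L2_diff[OF f pfun_L2[of p]] w] sums_unique2 by simp
qed

text \<open>Parseval for the partial sums, the factors r^i \<le> 1 and Bessel bound every partial
  sum; Fatou passes to the limit. The bound is uniform in r and gives both membership in the Hardy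
  class and control of the error in \<open>taylor_sum_boundary_value\<close>.\<close>

lemma nn_integral_taylor_sum:
  assumes f: "f \<in> L2" and r: "0 \<le> r" "r < 1"
  shows "(\<integral>\<^sup>+z. ennreal ((cmod (taylor_sum f (of_real r * z)))\<^sup>2) \<partial>circle_measure) \<le> ennreal ((L2_norm f)\<^sup>2)"
proof -
  define p where "p N = (\<Sum>i\<le>N. monom (ip f (zpow i) * of_real r ^ i) i)" for N
  have poly_p: "poly (p N) z = (\<Sum>i\<le>N. ip f (zpow i) * (of_real r * z) ^ i)" for N z
    by (simp add: p_def poly_sum poly_monom power_mult_distrib mult.assoc)
  have c: "coeff (p N) i = (if i \<le> N then ip f (zpow i) * of_real r ^ i else 0)" for N i
    by (simp add: p_def coeff_sum coeff_monom)
  have d: "degree (p N) \<le> N" for N by (rule degree_le) (simp add: c)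
  have norm_p: "(L2_norm (pfun (p N)))\<^sup>2 \<le> (L2_norm f)\<^sup>2" for N
  proof -
    have "(L2_norm (pfun (p N)))\<^sup>2 = (\<Sum>i\<le>N. (cmod (ip f (zpow i)))\<^sup>2 * (r ^ i)\<^sup>2)"
      using r by (simp add: L2_norm_pfun[OF d] c norm_mult norm_power power_mult_distrib)
    also have "\<dots> \<le> (\<Sum>i\<le>N. (cmod (ip f (zpow i)))\<^sup>2 * 1)"
      using r by (intro sum_mono mult_left_mono) (auto simp: power_le_one)
    also have "\<dots> \<le> (L2_norm f)\<^sup>2" using Bessel[OF f] by simp
    finally show ?thesis .
  qed
  have "(\<integral>\<^sup>+z. ennreal ((cmod (taylor_sum f (of_real r * z)))\<^sup>2) \<partial>circle_measure) =
     (\<integral>\<^sup>+z. liminf (\<lambda>N. ennreal ((cmod (poly (p N) z))\<^sup>2)) \<partial>circle_measure)"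
  proof (rule nn_integral_cong)
    fix z assume "z \<in> space circle_measure"
    hence "cmod (of_real r * z) < 1" using r by (simp add: norm_mult)
    hence "(\<lambda>N. poly (p N) z) \<longlonglongrightarrow> taylor_sum f (of_real r * z)"
      using taylor_sums[OF f] unfolding poly_p sums_def_le by blast
    hence "(\<lambda>N. ennreal ((cmod (poly (p N) z))\<^sup>2)) \<longlonglongrightarrow> ennreal ((cmod (taylor_sum f (of_real r * z)))\<^sup>2)"
      by (intro tendsto_intros)
    from lim_imp_Liminf[OF trivial_limit_sequentially this]
    show "ennreal ((cmod (taylor_sum f (of_real r * z)))\<^sup>2) = liminf (\<lambda>N. ennreal ((cmod (poly (p N) z))\<^sup>2))"
      by simp
  qed
  also have "\<dots> \<le> liminf (\<lambda>N. \<integral>\<^sup>+z. ennreal ((cmod (poly (p N) z))\<^sup>2) \<partial>circle_measure)"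
    by (rule nn_integral_liminf) measurable
  also have "\<dots> \<le> liminf (\<lambda>N::nat. ennreal ((L2_norm f)\<^sup>2))"
  proof (intro Liminf_mono always_eventually allI)
    fix N
    have "(\<integral>\<^sup>+z. ennreal ((cmod (poly (p N) z))\<^sup>2) \<partial>circle_measure) = ennreal ((L2_norm (pfun (p N)))\<^sup>2)"
      unfolding pfun_eq_abs using pfun_L2[of "p N"] by (intro nn_integral_L2_norm) (auto simp: pfun_eq_abs)
    also have "\<dots> \<le> ennreal ((L2_norm f)\<^sup>2)" using norm_p by (rule ennreal_leI)
    finally show "(\<integral>\<^sup>+z. ennreal ((cmod (poly (p N) z))\<^sup>2) \<partial>circle_measure) \<le> ennreal ((L2_norm f)\<^sup>2)" .
  qed
  finally show ?thesis by (simp add: Liminf_const)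
qed

text \<open>By Parseval the distance is a finite sum of terms, each continuous in r and 0 at r =
  1.\<close>

lemma dilate_pfun_tendsto:
  "((\<lambda>r::real. (L2_norm (pfun (pcompose p [:0, of_real r:]) - pfun p))\<^sup>2) \<longlongrightarrow> 0) (at_left 1)"
proof -
  have "(L2_norm (pfun (pcompose p [:0, of_real r:]) - pfun p))\<^sup>2 =
      (\<Sum>i\<le>degree p. (cmod (of_real r ^ i * coeff p i - coeff p i))\<^sup>2)" for r :: real
  proof -
    have c: "coeff (pcompose p [:0, of_real r:] - p) i = of_real r ^ i * coeff p i - coeff p i" for i
      by (simp add: coeff_pcompose_linear)
    have "degree (pcompose p [:0, of_real r:] - p) \<le> degree p"
      by (rule degree_le) (simp add: c coeff_eq_0 del: coeff_diff)
    from L2_norm_pfun[OF this] show ?thesis by (simp only: pfun_diff c)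
  qed
  moreover have "((\<lambda>r::real. \<Sum>i\<le>degree p. (cmod (of_real r ^ i * coeff p i - coeff p i))\<^sup>2) \<longlongrightarrow>
      (\<Sum>i\<le>degree p. (cmod (of_real 1 ^ i * coeff p i - coeff p i))\<^sup>2)) (at_left 1)"
    by (intro tendsto_intros)
  ultimately show ?thesis by simp
qed

text \<open>For a polynomial p near f three distances are small: the extension of f - p on the
  circle of radius r, uniformly in r; the dilate of p against p, for r near 1; and p against
  f.\<close>

lemma taylor_sum_boundary_value:
  assumes f: "f \<in> L2" and approx: "\<And>e. e > 0 \<Longrightarrow> \<exists>p. L2_norm (f - pfun p) < e"
  shows "boundary_value (taylor_sum f) f"
proof -
  obtain G where G [measurable]: "G \<in> borel_measurable circle_measure" and fG: "f = abs_circle_fun G"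
    by (rule circle_fun_representative)
  let ?I = "\<lambda>r::real. \<integral>\<^sup>+z. ennreal ((cmod (taylor_sum f (of_real r * z) - G z))\<^sup>2) \<partial>circle_measure"
  have *: "eventually (\<lambda>r. ?I r \<le> ennreal e) (at_left 1)" if e: "e > 0" for e :: real
  proof -
    \<comment> \<open>The factor 2 is paid twice: 2/12 + 2/12 = 1/3, and 2/12 + 2/3 is below
      1.\<close>
    define d where "d = sqrt (e / 12)"
    have d: "d > 0" "d\<^sup>2 = e / 12" using e by (auto simp: d_def)
    obtain p where p: "L2_norm (f - pfun p) < d" using approx[OF d(1)] by blast
    have pd: "(L2_norm (f - pfun p))\<^sup>2 \<le> e / 12"
      unfolding d(2)[symmetric] using p by (intro power_mono) auto
    have "eventually (\<lambda>r::real. (L2_norm (pfun (pcompose p [:0, of_real r:]) - pfun p))\<^sup>2 < e / 12) (at_left 1)"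
      using e by (intro order_tendstoD(2)[OF dilate_pfun_tendsto]) auto
    moreover have "eventually (\<lambda>r::real. r \<in> {0<..<1}) (at_left 1)"
      by (rule eventually_at_left_real) simp
    ultimately show ?thesis
    proof eventually_elim
      case (elim r)
      define q where "q = pcompose p [:0, of_real r:]"
      have q: "poly q z = poly p (of_real r * z)" for z by (simp add: q_def poly_pcompose mult.commute)
      have [measurable]: "(\<lambda>z. taylor_sum f (of_real r * z)) \<in> borel_measurable circle_measure"
        using elim taylor_sum_holomorphic[OF f] by (intro measurable_dilate) auto
      have "(\<integral>\<^sup>+z. ennreal ((cmod (taylor_sum f (of_real r * z) - poly q z))\<^sup>2) \<partial>circle_measure) =
          (\<integral>\<^sup>+z. ennreal ((cmod (taylor_sum (f - pfun p) (of_real r * z)))\<^sup>2) \<partial>circle_measure)"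
        using elim by (intro nn_integral_cong) (simp add: q taylor_sum_diff_pfun[OF f] norm_mult)
      also have "\<dots> \<le> ennreal ((L2_norm (f - pfun p))\<^sup>2)"
        using elim f by (intro nn_integral_taylor_sum) auto
      also have "\<dots> \<le> ennreal (e / 12)" using pd by (rule ennreal_leI)
      finally have 1: "(\<integral>\<^sup>+z. ennreal ((cmod (taylor_sum f (of_real r * z) - poly q z))\<^sup>2) \<partial>circle_measure) \<le> ennreal (e / 12)" .
      have a: "pfun q - pfun p = abs_circle_fun (\<lambda>z. poly q z - poly p z)" "pfun p - f = abs_circle_fun (\<lambda>z. poly p z - G z)"
        by (simp_all add: fG pfun_eq_abs minus_circle_fun.abs_eq ae_rel_def)
      have 2: "(\<integral>\<^sup>+z. ennreal ((cmod (poly q z - poly p z))\<^sup>2) \<partial>circle_measure) \<le> ennreal (e / 12)"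
        using elim L2_diff[OF pfun_L2[of q] pfun_L2[of p]] unfolding a(1) q_def[symmetric]
        by (subst nn_integral_L2_norm) (auto intro!: ennreal_leI)
      have 3: "(\<integral>\<^sup>+z. ennreal ((cmod (poly p z - G z))\<^sup>2) \<partial>circle_measure) \<le> ennreal (e / 12)"
        using pd L2_diff[OF pfun_L2[of p] f] unfolding L2_norm_minus_commute[of f] a(2)
        by (subst nn_integral_L2_norm) (auto intro!: ennreal_leI)
      have "(\<integral>\<^sup>+z. ennreal ((cmod (poly q z - G z))\<^sup>2) \<partial>circle_measure) \<le> 2 * ennreal (e / 12) + 2 * ennreal (e / 12)"
        by (rule order_trans[OF nn_integral_sq_triangle[of _ "poly p"]]) (auto intro!: add_mono mult_left_mono 2 3)
      also have "\<dots> = ennreal (e / 3)"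
        unfolding two_ennreal using e by (subst ennreal_plus[symmetric]) auto
      finally have 4: "(\<integral>\<^sup>+z. ennreal ((cmod (poly q z - G z))\<^sup>2) \<partial>circle_measure) \<le> ennreal (e / 3)" .
      have "?I r \<le> 2 * ennreal (e / 12) + 2 * ennreal (e / 3)"
        by (rule order_trans[OF nn_integral_sq_triangle[of _ "poly q"]]) (auto intro!: add_mono mult_left_mono 1 4)
      also have "\<dots> \<le> ennreal e"
        unfolding two_ennreal using e by (subst ennreal_plus[symmetric]) (auto intro!: ennreal_leI)
      finally show ?case .
    qed
  qed
  have "(?I \<longlongrightarrow> 0) (at_left 1)"
  proof (rule order_tendstoI)
    fix a :: ennreal assume "0 < a"
    \<comment> \<open>An intermediate \<open>b\<close> is finite even if \<open>a\<close> is
      infinite, so the real estimate applies.\<close>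
    then obtain b where b: "0 < b" "b < a" using dense by blast
    then obtain e where e: "b = ennreal e" "e > 0" by (cases b) auto
    from *[OF e(2)] show "eventually (\<lambda>r. ?I r < a) (at_left 1)"
      using b e by (auto elim!: eventually_mono)
  qed auto
  thus ?thesis by (simp add: fG boundary_value.abs_eq ae_rel_def)
qed

text \<open>For the converse the holomorphic function is \<open>taylor_sum f\<close>. Afterwards
  elements of \<open>H2\<close> are handled only through polynomials.\<close>

lemma H2_iff: "f \<in> H2 \<longleftrightarrow> f \<in> L2 \<and> (\<forall>e>0. \<exists>p. L2_norm (f - pfun p) < e)"
proof
  assume "f \<in> H2"
  thus "f \<in> L2 \<and> (\<forall>e>0. \<exists>p. L2_norm (f - pfun p) < e)"
    using boundary_value_approx by (auto simp: H2_def hardy2_disc_def)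
next
  assume f: "f \<in> L2 \<and> (\<forall>e>0. \<exists>p. L2_norm (f - pfun p) < e)"
  have "hardy2_disc (taylor_sum f)"
    unfolding hardy2_disc_def using f taylor_sum_holomorphic nn_integral_taylor_sum
    by (auto intro!: exI[of _ "(L2_norm f)\<^sup>2"])
  with f taylor_sum_boundary_value[of f] show "f \<in> H2" by (auto simp: H2_def)
qed

lemma pfun_H2 [simp]: "pfun p \<in> H2"
  by (auto simp: H2_iff intro!: exI[of _ p])

lemma H2_subspace: "L2_subspace H2"
  unfolding L2_subspace_def
proof (intro conjI ballI allI)
  show "H2 \<subseteq> L2" by (auto simp: H2_iff)
  show "0 \<in> H2" using pfun_H2[of 0] by simp
  fix f h assume f: "f \<in> H2" and h: "h \<in> H2"
  have "\<exists>p. L2_norm (f + h - pfun p) < e" if "e > 0" for e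
  proof -
    obtain p q where pq: "L2_norm (f - pfun p) < e / 2" "L2_norm (h - pfun q) < e / 2"
      using f h \<open>e > 0\<close> unfolding H2_iff by (meson half_gt_zero)
    have "f + h - pfun (p + q) = (f - pfun p) + (h - pfun q)" by (simp add: pfun_add)
    hence "L2_norm (f + h - pfun (p + q)) \<le> L2_norm (f - pfun p) + L2_norm (h - pfun q)"
      using f h by (simp only:) (intro L2_norm_triangle; auto simp: H2_iff)
    with pq show ?thesis by (intro exI[of _ "p + q"]) linarith
  qed
  thus "f + h \<in> H2" using f h by (auto simp: H2_iff)
next
  fix c f assume f: "f \<in> H2"
  have "\<exists>p. L2_norm (const_fun c * f - pfun p) < e" if "e > 0" for e
  proof -
    \<comment> \<open>The summand 1 covers c = 0.\<close>
    have "e / (cmod c + 1) > 0" using that by (simp add: add_nonneg_pos)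
    then obtain p where p: "L2_norm (f - pfun p) < e / (cmod c + 1)"
      using f unfolding H2_iff by blast
    have "L2_norm (const_fun c * f - pfun (smult c p)) = cmod c * L2_norm (f - pfun p)"
      by (simp add: pfun_smult L2_norm_const flip: right_diff_distrib)
    also have "\<dots> \<le> (cmod c + 1) * L2_norm (f - pfun p)" by (intro mult_right_mono) auto
    also have "\<dots> < (cmod c + 1) * (e / (cmod c + 1))"
      using p by (intro mult_strict_left_mono) (auto simp: add_nonneg_pos)
    also have "\<dots> = e" by (metis add_pos_nonneg add.commute norm_ge_zero zero_less_one less_irrefl nonzero_mult_div_cancel_left times_divide_eq_right)
    finally show ?thesis by blast
  qed
  thus "const_fun c * f \<in> H2" using f by (auto simp: H2_iff)
qed

lemma H2_closed: "L2_closed H2"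
  unfolding L2_closed_def
proof (intro ballI impI)
  fix f assume f: "f \<in> L2" "\<forall>e>0. \<exists>s\<in>H2. L2_norm (f - s) < e"
  have "\<exists>p. L2_norm (f - pfun p) < e" if "e > 0" for e
  proof -
    have "e / 2 > 0" using that by simp
    then obtain s where s: "s \<in> H2" "L2_norm (f - s) < e / 2" using f(2) by blast
    obtain p where p: "L2_norm (s - pfun p) < e / 2" using s(1) \<open>e / 2 > 0\<close> unfolding H2_iff by blast
    have "L2_norm (f - pfun p) \<le> L2_norm (f - s) + L2_norm (s - pfun p)"
      using f s by (intro L2_norm_triangle_diff) (auto simp: H2_iff)
    with s p show ?thesis by (intro exI[of _ p]) linarith
  qed
  with f show "f \<in> H2" by (auto simp: H2_iff)
qed

text \<open>By Cauchy-Schwarz orthogonality passes to \<open>L2\<close> limits. The approximants are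
  taken in the second argument and may depend on e.\<close>

lemma ip_zeroI:
  assumes f: "f \<in> L2" and h: "h \<in> L2"
    and approx: "\<And>e. e > 0 \<Longrightarrow> \<exists>d\<in>L2. ip f d = 0 \<and> L2_norm (h - d) < e"
  shows "ip f h = 0"
proof -
  have "cmod (ip f h) \<le> 0 + e" if "e > 0" for e
  proof -
    have "e / (L2_norm f + 1) > 0" using that by (simp add: add_nonneg_pos)
    then obtain d where d: "d \<in> L2" "ip f d = 0" "L2_norm (h - d) < e / (L2_norm f + 1)"
      using approx by blast
    have "ip f h = ip f (h - d)" using d f h by (simp add: ip_diff_right)
    hence "cmod (ip f h) \<le> L2_norm f * L2_norm (h - d)"
      using Cauchy_Schwarz_L2[of f "h - d"] f h d by auto
    also have "\<dots> \<le> (L2_norm f + 1) * (e / (L2_norm f + 1))"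
      using d by (intro mult_mono) auto
    also have "\<dots> = e" by (metis add_pos_nonneg add.commute L2_norm_nonneg zero_less_one less_irrefl nonzero_mult_div_cancel_left times_divide_eq_right)
    finally show ?thesis by simp
  qed
  hence "cmod (ip f h) \<le> 0" by (rule field_le_epsilon)
  thus ?thesis by simp
qed

subsection \<open>Model spaces\<close>

lemma inner_function_approx:
  assumes "inner_function \<theta>" "e > 0"
  shows "\<exists>p. L2_norm (\<theta> - pfun p) < e"
  using assms boundary_value_approx by (auto simp: inner_function_def Hinf_def hardy_inf_disc_def)

lemma unimodular_zpow: "unimodular (zpow n)"
  unfolding zpow_def by transfer (auto intro!: AE_I2 simp: poly_monom norm_power)

context
  fixes \<theta> assumes \<theta>: "inner_function \<theta>"
begin

lemma inner_uni: "unimodular \<theta>" and inner_Linf: "\<theta> \<in> Linf"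
  using \<theta> by (auto simp: inner_function_def unimodular_Linf)

text \<open>\<theta> is an \<open>L2\<close> limit of polynomials, and multiplication by the bounded
  function \<open>pfun q\<close> preserves this limit.\<close>

lemma inner_times_pfun_H2: "\<theta> * pfun q \<in> H2"
  unfolding H2_iff
proof (intro conjI allI impI)
  show "\<theta> * pfun q \<in> L2" using inner_Linf by auto
  fix e :: real assume "e > 0"
  obtain C where C: "C > 0" "\<And>f. f \<in> L2 \<Longrightarrow> L2_norm (pfun q * f) \<le> C * L2_norm f"
    using Linf_times_L2_bound[OF pfun_Linf] by blast
  obtain p where p: "L2_norm (\<theta> - pfun p) < e / C"
    using inner_function_approx[OF \<theta>, of "e / C"] \<open>e > 0\<close> C by auto
  have "L2_norm (\<theta> * pfun q - pfun (q * p)) = L2_norm (pfun q * (\<theta> - pfun p))"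
    by (simp add: pfun_mult algebra_simps)
  also have "\<dots> \<le> C * L2_norm (\<theta> - pfun p)"
    using inner_Linf by (intro C) (auto intro: Linf_subset_L2)
  also have "\<dots> < e" using p C by (simp add: field_simps)
  finally show "\<exists>p. L2_norm (\<theta> * pfun q - pfun p) < e" by blast
qed

lemma model_space_subspace: "L2_subspace (model_space \<theta>)"
proof -
  have "\<theta> * h \<in> L2" if "h \<in> H2" for h using that inner_Linf by (auto simp: H2_iff)
  thus ?thesis
    using L2_subspaceD[OF H2_subspace] unfolding L2_subspace_def model_space_def
    by (auto simp: ip_add_left ip_const_left)
qed

lemma model_space_closed: "L2_closed (model_space \<theta>)"
  unfolding L2_closed_def
proof (intro ballI impI)
  fix f assume f: "f \<in> L2" "\<forall>e>0. \<exists>s\<in>model_space \<theta>. L2_norm (f - s) < e"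
  have "f \<in> H2"
    using H2_closed f unfolding L2_closed_def model_space_def by blast
  moreover have "ip f (\<theta> * h) = 0" if "h \<in> H2" for h
  proof -
    \<comment> \<open>The arguments are swapped because \<open>ip_zeroI\<close> approximates the
      second one.\<close>
    have "ip (\<theta> * h) f = 0"
    proof (rule ip_zeroI)
      fix e :: real assume "e > 0"
      then obtain s where s: "s \<in> model_space \<theta>" "L2_norm (f - s) < e" using f by blast
      have "ip s (\<theta> * h) = 0" using s that by (auto simp: model_space_def)
      hence "ip (\<theta> * h) s = 0" using ip_commute[of "\<theta> * h" s] by simp
      thus "\<exists>d\<in>L2. ip (\<theta> * h) d = 0 \<and> L2_norm (f - d) < e"
        using s L2_subspaceD(1)[OF model_space_subspace] by blast
    qed (use that f inner_Linf in \<open>auto simp: H2_iff\<close>)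
    thus ?thesis using ip_commute[of f "\<theta> * h"] by simp
  qed
  ultimately show "f \<in> model_space \<theta>" by (simp add: model_space_def)
qed

text \<open>For polynomials p close to \<theta>, the product of p with z^m has no coefficient of
  index below m.\<close>

lemma ip_zpow_inner:
  assumes "i < m"
  shows "ip (zpow i) (\<theta> * zpow m) = 0"
proof (rule ip_zeroI)
  show "\<theta> * zpow m \<in> L2" using inner_Linf by auto
  fix e :: real assume "e > 0"
  then obtain p where p: "L2_norm (\<theta> - pfun p) < e" using inner_function_approx[OF \<theta>] by blast
  have "ip (pfun (monom 1 m * p)) (zpow i) = 0"
    using assms by (simp add: ip_pfun_zpow coeff_monom_mult)
  hence "ip (zpow i) (pfun p * zpow m) = 0"
    using ip_commute[of "zpow i"] by (simp add: zpow_def pfun_mult mult.commute)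
  moreover have "L2_norm (\<theta> * zpow m - pfun p * zpow m) = L2_norm (\<theta> - pfun p)"
    using L2_norm_unimodular[OF unimodular_zpow[of m], of "\<theta> - pfun p"] by (simp add: algebra_simps)
  ultimately show "\<exists>d\<in>L2. ip (zpow i) d = 0 \<and> L2_norm (\<theta> * zpow m - d) < e"
    using p by (intro bexI[of _ "pfun p * zpow m"]) auto
qed simp

text \<open>\<open>q\<close> is the analytic part of \<open>cnj \<theta> * p\<close>, which is again a polynomial.  So the projection of
  a polynomial onto the model space is bounded.\<close>

lemma projected_polynomial:
  obtains q where "pfun p - \<theta> * pfun q \<in> model_space \<theta>"
proof
  define q where "q = (\<Sum>i\<le>degree p. monom (ip (pfun p) (\<theta> * zpow i)) i)"
  have \<theta>z: "\<theta> * zpow i \<in> L2" for i using inner_Linf by auto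
  \<comment> \<open>Cutting \<open>q\<close> off at the degree of \<open>p\<close> loses nothing: by
    \<open>ip_zpow_inner\<close> the Fourier coefficients of
    \<open>cnj_fun \<theta> * pfun p\<close> of larger index vanish.\<close>
  have coeff_q: "coeff q m = ip (pfun p) (\<theta> * zpow m)" for m
  proof (cases "m \<le> degree p")
    case False
    have "ip (pfun p) (\<theta> * zpow m) = (\<Sum>i\<le>degree p. ip (const_fun (coeff p i) * zpow i) (\<theta> * zpow m))"
      using \<theta>z by (subst pfun_expand[OF order_refl], intro ip_sum_left) auto
    also have "\<dots> = 0"
      using False by (intro sum.neutral) (auto simp: ip_const_left ip_zpow_inner)
    finally show ?thesis using False by (simp add: q_def coeff_sum coeff_monom)
  qed (simp add: q_def coeff_sum coeff_monom)
  let ?k = "pfun p - \<theta> * pfun q"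
  have \<theta>q: "\<theta> * pfun q \<in> L2" using inner_Linf by auto
  have kL2: "?k \<in> L2" using \<theta>q by auto
  \<comment> \<open>\<theta> is unimodular, so the contribution of \<open>\<theta> * pfun q\<close>
    is \<open>coeff q m\<close>. Orthogonality then spreads to polynomials by linearity and to
    \<open>H2\<close> by density.\<close>
  have "ip ?k (\<theta> * zpow m) = 0" for m
    using \<theta>q \<theta>z by (simp add: ip_diff_left ip_unimodular[OF inner_uni] ip_pfun_zpow coeff_q)
  hence pol: "ip ?k (\<theta> * pfun s) = 0" for s
  proof -
    have "\<theta> * pfun s = (\<Sum>i\<le>degree s. const_fun (coeff s i) * (\<theta> * zpow i))"
      by (simp add: pfun_expand[OF order_refl, of s] sum_distrib_left mult.left_commute)
    hence "ip ?k (\<theta> * pfun s) = (\<Sum>i\<le>degree s. ip ?k (const_fun (coeff s i) * (\<theta> * zpow i)))"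
      using \<theta>z kL2 by (simp only:) (intro ip_sum_right; auto)
    thus ?thesis using \<open>\<And>m. ip ?k (\<theta> * zpow m) = 0\<close> by (simp add: ip_const_right)
  qed
  have "ip ?k (\<theta> * h) = 0" if "h \<in> H2" for h
  proof (rule ip_zeroI[OF kL2])
    fix e :: real assume "e > 0"
    then obtain s where s: "L2_norm (h - pfun s) < e" using \<open>h \<in> H2\<close> unfolding H2_iff by blast
    have "L2_norm (\<theta> * h - \<theta> * pfun s) = L2_norm (h - pfun s)"
      using L2_norm_unimodular[OF inner_uni, of "h - pfun s"] by (simp add: algebra_simps)
    thus "\<exists>d\<in>L2. ip ?k d = 0 \<and> L2_norm (\<theta> * h - d) < e"
      using s pol inner_Linf by (intro bexI[of _ "\<theta> * pfun s"]) auto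
  qed (use that inner_Linf in \<open>auto simp: H2_iff\<close>)
  moreover have "?k \<in> H2"
    using L2_subspaceD(6)[OF H2_subspace] inner_times_pfun_H2 by auto
  ultimately show "?k \<in> model_space \<theta>" by (simp add: model_space_def)
qed

text \<open>Projecting a polynomial p near f gives a bounded k that is no farther from f: f - k lies
  in the model space, hence is orthogonal to \<open>\<theta> * pfun q\<close>, and Pythagoras
  applies to f - p.\<close>

lemma model_space_dense: "L2_dense (model_space \<theta> \<inter> Linf) (model_space \<theta>)"
  unfolding L2_dense_def
proof (intro conjI ballI allI impI)
  note K = L2_subspaceD[OF model_space_subspace]
  fix f and e :: real assume f: "f \<in> model_space \<theta>" and "e > 0"
  then obtain p where p: "L2_norm (f - pfun p) < e" by (auto simp: model_space_def H2_iff)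
  obtain q where q: "pfun p - \<theta> * pfun q \<in> model_space \<theta>" by (rule projected_polynomial)
  define k where "k = pfun p - \<theta> * pfun q"
  have \<theta>q: "\<theta> * pfun q \<in> Linf" using inner_Linf by auto
  have kL: "k \<in> Linf"
    using Linf_add[OF pfun_Linf[of p] Linf_mult[OF const_fun_Linf[of "-1"] \<theta>q]] by (simp add: k_def const_fun_simps)
  have "f - k \<in> model_space \<theta>" using K f q by (auto simp: k_def)
  hence ip0: "ip (f - k) (\<theta> * pfun q) = 0" and fk: "f - k \<in> L2" using K(1) by (auto simp: model_space_def)
  have eq: "f - pfun p = (f - k) - \<theta> * pfun q" by (simp add: k_def)
  have "(L2_norm (f - pfun p))\<^sup>2 = (L2_norm (f - k))\<^sup>2 + (L2_norm (\<theta> * pfun q))\<^sup>2"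
    unfolding eq L2_norm_diff_sq[OF fk Linf_subset_L2[OF \<theta>q]] ip0 by simp
  hence "(L2_norm (f - k))\<^sup>2 \<le> (L2_norm (f - pfun p))\<^sup>2" by simp
  hence "L2_norm (f - k) \<le> L2_norm (f - pfun p)" by (rule power2_le_imp_le) simp
  with p q kL show "\<exists>d\<in>model_space \<theta> \<inter> Linf. L2_norm (f - d) < e"
    by (intro bexI[of _ k]) (auto simp: k_def)
qed auto

end

subsection \<open>Dual-band Toeplitz operators\<close>

locale dual_band_space =
  fixes \<theta> \<phi> \<psi> :: circle_fun
  assumes inner: "inner_function \<theta>" and \<phi>: "unimodular \<phi>" and \<psi>: "unimodular \<psi>"
    and orth: "orthogonal_sets (times_set \<phi> (model_space \<theta>)) (times_set \<psi> (model_space \<theta>))"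
begin

abbreviation K :: "circle_fun set" where "K \<equiv> model_space \<theta>"
abbreviation M :: "circle_fun set" where "M \<equiv> dual_band \<theta> \<phi> \<psi>"

definition U :: "circle_fun \<times> circle_fun \<Rightarrow> circle_fun" where
  "U = (\<lambda>(a, b). \<phi> * a + \<psi> * b)"

lemmas K_sub = model_space_subspace[OF inner]
lemmas K_closed = model_space_closed[OF inner]
lemmas K_dense = model_space_dense[OF inner]
lemmas K_proj = closed_has_projection[OF K_sub K_closed]
lemmas KD = L2_subspaceD[OF K_sub]

lemma Linf_bands: "\<phi> \<in> Linf" "\<psi> \<in> Linf" "cnj_fun \<phi> \<in> Linf" "cnj_fun \<psi> \<in> Linf"
  using unimodular_Linf[OF \<phi>] unimodular_Linf[OF \<psi>] by auto

lemma M_eq: "M = U ` (K \<times> K)"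
  by (force simp: dual_band_def sum_set_def times_set_def U_def)

lemma U_add: "U (a + c, b + d) = U (a, b) + U (c, d)"
  by (simp add: U_def algebra_simps)

lemma U_diff: "U (a - c, b - d) = U (a, b) - U (c, d)"
  by (simp add: U_def algebra_simps)

lemma U_const: "U (const_fun k * a, const_fun k * b) = const_fun k * U (a, b)"
  by (simp add: U_def algebra_simps)

lemma U_L2: "a \<in> L2 \<Longrightarrow> b \<in> L2 \<Longrightarrow> U (a, b) \<in> L2"
  using Linf_bands by (auto simp: U_def)

lemma U_M: "a \<in> K \<Longrightarrow> b \<in> K \<Longrightarrow> U (a, b) \<in> M"
  by (auto simp: M_eq)

lemma ip_U:
  assumes "a \<in> K" "b \<in> K" "c \<in> K" "d \<in> K"
  shows "ip (U (a, b)) (U (c, d)) = ip a c + ip b d"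
proof -
  have "ip (\<phi> * x) (\<psi> * y) = 0" "ip (\<psi> * x) (\<phi> * y) = 0" if "x \<in> K" "y \<in> K" for x y
    using orth that ip_commute[of "\<psi> * x" "\<phi> * y"] by (auto simp: orthogonal_sets_def times_set_def)
  moreover have "\<phi> * x \<in> L2" "\<psi> * x \<in> L2" if "x \<in> K" for x using that KD(1) Linf_bands by auto
  ultimately show ?thesis
    using assms by (simp add: U_def ip_add_left ip_add_right L2_add ip_unimodular \<phi> \<psi>)
qed

lemma norm_U: "a \<in> K \<Longrightarrow> b \<in> K \<Longrightarrow> (L2_norm (U (a, b)))\<^sup>2 = (L2_norm a)\<^sup>2 + (L2_norm b)\<^sup>2"
  by (simp add: L2_norm_eq ip_U)

text \<open>Gives the injectivity of \<open>U\<close>, and later lets a bound on the operator on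
  \<open>M\<close> pass to the single entries.\<close>

lemma norm_le_U:
  assumes "a \<in> K" "b \<in> K"
  shows "L2_norm a \<le> L2_norm (U (a, b))" "L2_norm b \<le> L2_norm (U (a, b))"
  by (rule power2_le_imp_le; simp add: norm_U assms)+

lemma norm_U_le:
  assumes "a \<in> K" "b \<in> K"
  shows "L2_norm (U (a, b)) \<le> L2_norm a + L2_norm b"
  by (rule power2_le_imp_le) (simp_all add: norm_U assms power2_sum)

lemma U_inj: "inj_on U (K \<times> K)"
proof (rule inj_onI, clarsimp)
  fix a b c d assume K: "a \<in> K" "b \<in> K" "c \<in> K" "d \<in> K" and eq: "U (a, b) = U (c, d)"
  have "L2_norm (a - c) \<le> L2_norm (U (a - c, b - d))" "L2_norm (b - d) \<le> L2_norm (U (a - c, b - d))"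
    using K KD(6) by (intro norm_le_U; blast)+
  hence "L2_norm (a - c) = 0" "L2_norm (b - d) = 0" by (simp_all add: U_diff eq antisym)
  moreover have "a - c \<in> L2" "b - d \<in> L2" using K KD by blast+
  ultimately show "a = c \<and> b = d" by (simp add: L2_norm_eq_0)
qed

lemma M_sub: "L2_subspace M"
  unfolding L2_subspace_def
proof (intro conjI ballI allI)
  show "M \<subseteq> L2" using U_L2 KD(1) by (auto simp: M_eq)
  show "0 \<in> M" using U_M[OF KD(2) KD(2)] by (simp add: U_def)
  show "f + h \<in> M" if "f \<in> M" "h \<in> M" for f h
    using that KD(3) unfolding M_eq by (auto simp flip: U_add)
  show "const_fun c * f \<in> M" if "f \<in> M" for c f
    using that KD(4) unfolding M_eq by (auto simp flip: U_const)
qed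

text \<open>\<open>U\<close> is isometric, so the projection onto its range is \<open>U\<close>
  followed after its adjoint. The adjoint sends f to the pair of projections onto \<open>K\<close>
  of \<open>cnj_fun \<phi> * f\<close> and \<open>cnj_fun \<psi> * f\<close>.\<close>

lemma projection_formula:
  assumes f: "f \<in> L2"
  shows "U (proj K (cnj_fun \<phi> * f), proj K (cnj_fun \<psi> * f)) \<in> M"
    and "h \<in> M \<Longrightarrow> ip (f - U (proj K (cnj_fun \<phi> * f), proj K (cnj_fun \<psi> * f))) h = 0"
proof -
  define a where "a = proj K (cnj_fun \<phi> * f)"
  define b where "b = proj K (cnj_fun \<psi> * f)"
  have \<phi>f: "cnj_fun \<phi> * f \<in> L2" and \<psi>f: "cnj_fun \<psi> * f \<in> L2" using f Linf_bands by auto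
  have ab: "a \<in> K" "b \<in> K" unfolding a_def b_def using proj_props(1)[OF K_proj] \<phi>f \<psi>f by auto
  show "U (proj K (cnj_fun \<phi> * f), proj K (cnj_fun \<psi> * f)) \<in> M" using ab U_M by (simp add: a_def b_def)
  assume "h \<in> M"
  then obtain c d where h: "h = U (c, d)" and cd: "c \<in> K" "d \<in> K" by (auto simp: M_eq)
  have L2: "a \<in> L2" "b \<in> L2" "c \<in> L2" "d \<in> L2" using ab cd KD by auto
  have "ip f h = ip f (\<phi> * c) + ip f (\<psi> * d)"
    unfolding h U_def using f L2 Linf_bands by (simp add: ip_add_right Linf_times_L2)
  also have "ip f (\<phi> * c) = ip (cnj_fun \<phi> * f) c"
    using ip_adjoint[of \<phi> c f] ip_commute by metis
  also have "ip f (\<psi> * d) = ip (cnj_fun \<psi> * f) d"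
    using ip_adjoint[of \<psi> d f] ip_commute by metis
  also have "ip (cnj_fun \<phi> * f) c = ip a c"
    using proj_props(2)[OF K_proj \<phi>f cd(1)] \<phi>f L2 by (simp add: a_def[symmetric] ip_diff_left)
  also have "ip (cnj_fun \<psi> * f) d = ip b d"
    using proj_props(2)[OF K_proj \<psi>f cd(2)] \<psi>f L2 by (simp add: b_def[symmetric] ip_diff_left)
  also have "ip a c + ip b d = ip (U (a, b)) h" using ab cd by (simp add: h ip_U)
  finally have "ip (f - U (a, b)) h = 0"
    using f L2 by (subst ip_diff_left) (auto simp: h U_L2)
  thus "ip (f - U (proj K (cnj_fun \<phi> * f), proj K (cnj_fun \<psi> * f))) h = 0" by (simp add: a_def b_def)
qed

lemma M_proj: "has_projection M"
  unfolding has_projection_def using M_sub projection_formula by blast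

lemma proj_M: "f \<in> L2 \<Longrightarrow> proj M f = U (proj K (cnj_fun \<phi> * f), proj K (cnj_fun \<psi> * f))"
  using projection_formula by (intro proj_eqI[OF M_sub]) auto

text \<open>The components are approximated separately, which gives more than density of
  \<open>M \<inter> Linf\<close>: the approximant has bounded components, as
  \<open>proj_M_block\<close> requires.\<close>

lemma dense_bands:
  assumes "a \<in> K" "b \<in> K" "e > 0"
  obtains a' b' where "a' \<in> K \<inter> Linf" "b' \<in> K \<inter> Linf" "L2_norm (U (a, b) - U (a', b')) < e"
proof -
  have "e / 2 > 0" using assms by simp
  then obtain a' b' where a': "a' \<in> K \<inter> Linf" "L2_norm (a - a') < e / 2"
    and b': "b' \<in> K \<inter> Linf" "L2_norm (b - b') < e / 2"
    using K_dense assms unfolding L2_dense_def by blast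
  have "a - a' \<in> K" "b - b' \<in> K" using a' b' assms KD(6) by blast+
  hence "L2_norm (U (a, b) - U (a', b')) \<le> L2_norm (a - a') + L2_norm (b - b')"
    unfolding U_diff[symmetric] by (rule norm_U_le)
  with a' b' that show ?thesis by fastforce
qed

lemma U_Linf: "a \<in> Linf \<Longrightarrow> b \<in> Linf \<Longrightarrow> U (a, b) \<in> Linf"
  using Linf_bands by (auto simp: U_def)

lemma M_dense: "L2_dense (M \<inter> Linf) M"
  unfolding L2_dense_def
proof (intro conjI ballI allI impI)
  fix f and e :: real assume "f \<in> M" "e > 0"
  then obtain a b where f: "f = U (a, b)" "a \<in> K" "b \<in> K" by (auto simp: M_eq)
  obtain a' b' where "a' \<in> K \<inter> Linf" "b' \<in> K \<inter> Linf" "L2_norm (U (a, b) - U (a', b')) < e"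
    using dense_bands[OF f(2,3) \<open>e > 0\<close>] .
  thus "\<exists>d\<in>M \<inter> Linf. L2_norm (f - d) < e"
    using U_M U_Linf f(1) by blast
qed auto

text \<open>On the diagonal \<phi> and \<psi> cancel against their conjugates and leave the symbol
  g; off the diagonal the two bands mix.\<close>

lemma proj_M_block:
  assumes g: "g \<in> L2" and a: "a \<in> K \<inter> Linf" and b: "b \<in> K \<inter> Linf"
  shows "proj M (g * U (a, b)) =
    U (proj K (g * a) + proj K (cnj_fun \<phi> * \<psi> * g * b), proj K (cnj_fun \<psi> * \<phi> * g * a) + proj K (g * b))"
proof -
  have L2: "u * g * x \<in> L2" "g * x \<in> L2" if "u \<in> Linf" "x \<in> Linf" for u x
    using Linf_times_L2[OF Linf_mult[OF that] g] Linf_times_L2[OF that(2) g] by (simp_all add: ac_simps)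
  have uni: "cnj_fun \<phi> * (\<phi> * x) = x" "cnj_fun \<psi> * (\<psi> * x) = x" for x
    by (simp_all add: cnj_unimodular \<phi> \<psi> flip: mult.assoc)
  have "g * U (a, b) \<in> L2"
    using Linf_times_L2[OF U_Linf g] a b by (simp add: mult.commute)
  moreover have "cnj_fun \<phi> * (g * U (a, b)) = g * a + cnj_fun \<phi> * \<psi> * g * b"
    using uni(1)[of "g * a"] by (simp add: U_def algebra_simps)
  moreover have "cnj_fun \<psi> * (g * U (a, b)) = cnj_fun \<psi> * \<phi> * g * a + g * b"
    using uni(2)[of "g * b"] by (simp add: U_def algebra_simps)
  ultimately show ?thesis
    using a b Linf_bands L2[of "cnj_fun \<phi> * \<psi>" b] L2[of "cnj_fun \<psi> * \<phi>" a] L2(2)[of _ a] L2(2)[of _ b]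
    by (simp add: proj_M proj_add[OF K_proj] Linf_mult)
qed

end

section \<open>The four entries, transport to \<open>M\<close> and the unitary equivalence\<close>

locale bounded_dual_band = dual_band_space +
  fixes g :: circle_fun
  assumes g: "g \<in> L2" and bdd: "bounded_compression M g"
begin

abbreviation g12 :: circle_fun where "g12 \<equiv> cnj_fun \<phi> * \<psi> * g"
abbreviation g21 :: circle_fun where "g21 \<equiv> cnj_fun \<psi> * \<phi> * g"

lemma entry_symbols_L2: "g12 \<in> L2" "g21 \<in> L2"
  using g Linf_bands by (auto intro!: Linf_times_L2 Linf_mult)

lemma proj_K_Linf: "h \<in> L2 \<Longrightarrow> a \<in> K \<inter> Linf \<Longrightarrow> proj K (h * a) \<in> K"
  using proj_props(1)[OF K_proj, of "h * a"] Linf_times_L2[of a h] by (simp add: mult.commute)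

text \<open>Testing the compression on \<open>U (a, 0)\<close> and \<open>U (0, a)\<close> isolates
  the columns of the block matrix. \<open>U\<close> preserves the norm of a and dominates each
  component of the image, so the same constant serves every entry.\<close>

lemma entries_bounded: "TTO_bounded \<theta> g" "TTO_bounded \<theta> g12" "TTO_bounded \<theta> g21"
proof -
  obtain C where C: "\<And>f. f \<in> M \<inter> Linf \<Longrightarrow> L2_norm (proj M (g * f)) \<le> C * L2_norm f"
    using bdd unfolding bounded_compression_def by blast
  have 0: "0 \<in> K \<inter> Linf" using L2_subspaceD(2)[OF L2_subspace_Linf[OF K_sub]] .
  have P0: "proj K 0 = 0" using proj_const[OF K_proj L2_zero, of 0] by (simp add: const_fun_simps)
  have norm_0: "L2_norm (U (a, 0)) = L2_norm a" "L2_norm (U (0, a)) = L2_norm a" for a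
    by (simp_all add: U_def L2_norm_unimodular \<phi> \<psi>)
  note PK = proj_K_Linf[OF g] proj_K_Linf[OF entry_symbols_L2(1)] proj_K_Linf[OF entry_symbols_L2(2)]
  have a: "L2_norm (proj K (g * a)) \<le> C * L2_norm a \<and> L2_norm (proj K (g21 * a)) \<le> C * L2_norm a"
    if a: "a \<in> K \<inter> Linf" for a
  proof -
    have "U (a, 0) \<in> M \<inter> Linf" using a 0 U_M U_Linf by auto
    from C[OF this] have "L2_norm (U (proj K (g * a), proj K (g21 * a))) \<le> C * L2_norm a"
      unfolding proj_M_block[OF g a 0] by (simp add: P0 norm_0)
    thus ?thesis
      using norm_le_U[OF PK(1)[OF a] PK(3)[OF a]] by auto
  qed
  have b: "L2_norm (proj K (g12 * a)) \<le> C * L2_norm a" if a: "a \<in> K \<inter> Linf" for a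
  proof -
    have "U (0, a) \<in> M \<inter> Linf" using a 0 U_M U_Linf by auto
    from C[OF this] have "L2_norm (U (proj K (g12 * a), proj K (g * a))) \<le> C * L2_norm a"
      unfolding proj_M_block[OF g 0 a] by (simp add: P0 norm_0)
    thus ?thesis
      using norm_le_U[OF PK(2)[OF a] PK(1)[OF a]] by auto
  qed
  show "TTO_bounded \<theta> g" "TTO_bounded \<theta> g12" "TTO_bounded \<theta> g21"
    unfolding bounded_compression_def using a b by blast+
qed

lemmas TTO_props = compression_props[OF K_sub K_closed K_dense g entries_bounded(1)]
  compression_props[OF K_sub K_closed K_dense entry_symbols_L2(1) entries_bounded(2)]
  compression_props[OF K_sub K_closed K_dense entry_symbols_L2(2) entries_bounded(3)]

definition W :: "circle_fun \<times> circle_fun \<Rightarrow> circle_fun \<times> circle_fun" where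
  "W = block_operator (TTO \<theta> g) (TTO \<theta> g12) (TTO \<theta> g21) (TTO \<theta> g)"

lemma W_simp: "W (a, b) = (TTO \<theta> g a + TTO \<theta> g12 b, TTO \<theta> g21 a + TTO \<theta> g b)"
  by (simp add: W_def block_operator_def)

lemma TTO_K: "a \<in> K \<Longrightarrow> TTO \<theta> g a \<in> K" "a \<in> K \<Longrightarrow> TTO \<theta> g12 a \<in> K" "a \<in> K \<Longrightarrow> TTO \<theta> g21 a \<in> K"
  using TTO_props(1,3,5) by (auto simp: bounded_operator_def)

lemma W_K: "x \<in> K \<times> K \<Longrightarrow> W x \<in> K \<times> K"
  using TTO_K KD(3) by (auto simp: W_simp)

text \<open>The conjugate of \<open>W\<close> by \<open>U\<close>, a candidate for the compression
  to \<open>M\<close>; the value 0 outside \<open>M\<close> matches the convention in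
  \<open>compression\<close>.\<close>

definition B :: "circle_fun \<Rightarrow> circle_fun" where
  "B f = (if f \<in> M then U (W (inv_into (K \<times> K) U f)) else 0)"

lemma B_U: "x \<in> K \<times> K \<Longrightarrow> B (U x) = U (W x)"
  using inv_into_f_f[OF U_inj] by (auto simp: B_def M_eq)

lemma TTO_linear:
  assumes "a \<in> K" "b \<in> K"
  shows "TTO \<theta> g (a + b) = TTO \<theta> g a + TTO \<theta> g b" "TTO \<theta> g12 (a + b) = TTO \<theta> g12 a + TTO \<theta> g12 b"
    "TTO \<theta> g21 (a + b) = TTO \<theta> g21 a + TTO \<theta> g21 b"
    "TTO \<theta> g (const_fun c * a) = const_fun c * TTO \<theta> g a" "TTO \<theta> g12 (const_fun c * a) = const_fun c * TTO \<theta> g12 a"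
    "TTO \<theta> g21 (const_fun c * a) = const_fun c * TTO \<theta> g21 a"
  using TTO_props(1,3,5) assms by (auto simp: bounded_operator_def)

lemma B_bounded: "bounded_operator M B"
  unfolding bounded_operator_def
proof (intro conjI ballI allI)
  show "B f \<in> M" if "f \<in> M" for f
    using that W_K unfolding M_eq by (force simp: B_U)
  show "B (f + h) = B f + B h" if "f \<in> M" "h \<in> M" for f h
  proof -
    obtain a b c d where f: "f = U (a, b)" and h: "h = U (c, d)" and K: "a \<in> K" "b \<in> K" "c \<in> K" "d \<in> K"
      using \<open>f \<in> M\<close> \<open>h \<in> M\<close> unfolding M_eq by blast
    have "B (f + h) = U (W (a + c, b + d))" using K KD(3) by (simp add: f h B_U flip: U_add)
    also have "\<dots> = U (W (a, b)) + U (W (c, d))"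
      using K by (simp add: W_simp TTO_linear add_ac flip: U_add)
    finally show ?thesis using K by (simp add: f h B_U)
  qed
  show "B (const_fun k * f) = const_fun k * B f" if "f \<in> M" for k f
  proof -
    obtain a b where f: "f = U (a, b)" and K: "a \<in> K" "b \<in> K" using \<open>f \<in> M\<close> unfolding M_eq by blast
    have "B (const_fun k * f) = U (W (const_fun k * a, const_fun k * b))" using K KD(4) by (simp add: f B_U flip: U_const)
    also have "\<dots> = const_fun k * U (W (a, b))"
      using K by (simp add: W_simp TTO_linear distrib_left flip: U_const)
    finally show ?thesis using K by (simp add: f B_U)
  qed
  obtain c1 where c1: "\<And>a. a \<in> K \<Longrightarrow> L2_norm (TTO \<theta> g a) \<le> c1 * L2_norm a"
    using TTO_props(1) unfolding bounded_operator_def by blast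
  obtain c2 where c2: "\<And>a. a \<in> K \<Longrightarrow> L2_norm (TTO \<theta> g12 a) \<le> c2 * L2_norm a"
    using TTO_props(3) unfolding bounded_operator_def by blast
  obtain c3 where c3: "\<And>a. a \<in> K \<Longrightarrow> L2_norm (TTO \<theta> g21 a) \<le> c3 * L2_norm a"
    using TTO_props(5) unfolding bounded_operator_def by blast
  \<comment> \<open>One summand per block entry; \<open>c1\<close> occurs twice because both
    diagonal entries have symbol g.\<close>
  have "L2_norm (B f) \<le> (\<bar>c1\<bar> + \<bar>c2\<bar> + \<bar>c3\<bar> + \<bar>c1\<bar>) * L2_norm f" if "f \<in> M" for f
  proof -
    obtain a b where f: "f = U (a, b)" and K: "a \<in> K" "b \<in> K" using \<open>f \<in> M\<close> unfolding M_eq by blast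
    have le: "c * L2_norm x \<le> \<bar>c\<bar> * L2_norm f" if "L2_norm x \<le> L2_norm f" for c x
      using that mult_mono[of c "\<bar>c\<bar>" "L2_norm x" "L2_norm f"] by simp
    have tri: "L2_norm (x + y) \<le> L2_norm x + L2_norm y" if "x \<in> K" "y \<in> K" for x y
      using that KD(1) by (intro L2_norm_triangle) auto
    have "L2_norm (B f) \<le> L2_norm (TTO \<theta> g a + TTO \<theta> g12 b) + L2_norm (TTO \<theta> g21 a + TTO \<theta> g b)"
      using K TTO_K KD(3) norm_U_le by (simp add: f B_U W_simp)
    also have "\<dots> \<le> (L2_norm (TTO \<theta> g a) + L2_norm (TTO \<theta> g12 b)) + (L2_norm (TTO \<theta> g21 a) + L2_norm (TTO \<theta> g b))"
      using K TTO_K by (intro add_mono tri) auto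
    also have "\<dots> \<le> (\<bar>c1\<bar> * L2_norm f + \<bar>c2\<bar> * L2_norm f) + (\<bar>c3\<bar> * L2_norm f + \<bar>c1\<bar> * L2_norm f)"
      using K norm_le_U[OF K] unfolding f[symmetric]
      by (intro add_mono order_trans[OF c1 le] order_trans[OF c2 le] order_trans[OF c3 le]) auto
    finally show ?thesis by (simp add: algebra_simps)
  qed
  thus "\<exists>C. \<forall>f\<in>M. L2_norm (B f) \<le> C * L2_norm f" by blast
qed

text \<open>A bounded \<open>\<phi> * a + \<psi> * b\<close> need not have bounded components, so the identity is checked on
  bounded components and then extended by continuity of both sides.\<close>

lemma B_eq_proj:
  assumes f: "f \<in> M \<inter> Linf"
  shows "B f = proj M (g * f)"
proof -
  obtain C where C: "\<And>f. f \<in> M \<inter> Linf \<Longrightarrow> L2_norm (proj M (g * f)) \<le> C * L2_norm f"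
    using bdd unfolding bounded_compression_def by blast
  obtain D where D: "\<And>f. f \<in> M \<Longrightarrow> L2_norm (B f) \<le> D * L2_norm f"
    using B_bounded unfolding bounded_operator_def by blast
  note MD = L2_subspaceD[OF M_sub] and MLD = L2_subspaceD[OF L2_subspace_Linf[OF M_sub]]
  have gL2: "g * h \<in> L2" if "h \<in> M \<inter> Linf" for h
    using that Linf_times_L2[OF _ g, of h] by (simp add: mult.commute)
  have PM: "proj M (g * h) \<in> M" if "h \<in> M \<inter> Linf" for h
    using proj_props(1)[OF M_proj gL2[OF that]] .
  have BM: "B h \<in> M" if "h \<in> M" for h using B_bounded that by (simp add: bounded_operator_def)
  show ?thesis
  proof (rule L2_eqI[of _ _ "\<bar>C\<bar> + \<bar>D\<bar>"])
    show "B f \<in> L2" "proj M (g * f) \<in> L2" using f BM PM MD(1) by auto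
    fix e :: real assume "e > 0"
    obtain a b where ab: "f = U (a, b)" "a \<in> K" "b \<in> K" using f by (auto simp: M_eq)
    obtain a' b' where a': "a' \<in> K \<inter> Linf" and b': "b' \<in> K \<inter> Linf"
      and close: "L2_norm (U (a, b) - U (a', b')) < e"
      using dense_bands[OF ab(2,3) \<open>e > 0\<close>] .
    define h where "h = U (a', b')"
    have h: "h \<in> M \<inter> Linf" using a' b' U_M U_Linf by (auto simp: h_def)
    have Bh: "B h = proj M (g * h)"
      using a' b' unfolding h_def proj_M_block[OF g a' b'] by (simp add: B_U W_simp TTO_props)
    \<comment> \<open>The difference is bounded although its components may not be, so the assumed
      bound \<open>C\<close> on the compression applies to it.\<close>
    have fh: "f - h \<in> M \<inter> Linf" using MLD(6)[OF f h] .
    have "proj M (g * f) = proj M (g * (f - h)) + proj M (g * h)"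
      using proj_add[OF M_proj gL2[OF fh] gL2[OF h]] by (simp add: algebra_simps)
    moreover have "B (f - h) = B f - B h" using bounded_operator_diff[OF B_bounded M_sub] f h by blast
    ultimately have "B f - proj M (g * f) = B (f - h) - proj M (g * (f - h))" by (simp add: Bh)
    hence "L2_norm (B f - proj M (g * f)) \<le> L2_norm (B (f - h)) + L2_norm (proj M (g * (f - h)))"
      using L2_norm_triangle_diff[of "B (f - h)" 0 "proj M (g * (f - h))"] fh BM PM MD(1) by auto
    also have "\<dots> \<le> D * L2_norm (f - h) + C * L2_norm (f - h)"
      using fh by (intro add_mono C D) auto
    also have "\<dots> \<le> \<bar>D\<bar> * L2_norm (f - h) + \<bar>C\<bar> * L2_norm (f - h)"
      by (intro add_mono mult_right_mono) auto
    also have "\<dots> = (\<bar>C\<bar> + \<bar>D\<bar>) * L2_norm (f - h)" by (simp add: algebra_simps)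
    also have "\<dots> \<le> (\<bar>C\<bar> + \<bar>D\<bar>) * e"
      using close by (intro mult_left_mono) (auto simp: ab h_def)
    finally show "L2_norm (B f - proj M (g * f)) \<le> (\<bar>C\<bar> + \<bar>D\<bar>) * e" .
  qed auto
qed

lemma compression_M: "compression M g = B"
  using B_eq_proj by (intro compression_eqI[OF M_sub M_dense B_bounded]) (auto simp: B_def)

lemma compression_equivalent: "unitarily_equivalent_sum M (compression M g) K W"
  unfolding unitarily_equivalent_sum_def
proof (intro exI[of _ U] conjI ballI)
  show "unitary_from_sum K M U"
    unfolding unitary_from_sum_def
    using U_inj by (auto simp: bij_betw_def M_eq U_add U_const ip_U)
  show "compression M g (U x) = U (W x)" if "x \<in> K \<times> K" for x
    using that by (simp add: compression_M B_U)
qed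

text \<open>\<open>U\<close> is injective, so the compression vanishes exactly when \<open>W\<close>
  does; the pairs \<open>(a, 0)\<close> and \<open>(0, b)\<close> read off the entries. The two
  diagonal entries coincide, which leaves three conditions.\<close>

lemma compression_zero_iff:
  "zero_operator M (compression M g) \<longleftrightarrow>
    zero_operator K (TTO \<theta> g) \<and> zero_operator K (TTO \<theta> g12) \<and> zero_operator K (TTO \<theta> g21)"
proof
  assume zero: "zero_operator M (compression M g)"
  have T0: "TTO \<theta> g 0 = 0" "TTO \<theta> g12 0 = 0" "TTO \<theta> g21 0 = 0"
    using TTO_linear(4-6)[OF KD(2) KD(2), of 0] by (simp_all add: const_fun_simps)
  have "W (a, b) = (0, 0)" if "a \<in> K" "b \<in> K" for a b
  proof -
    have "U (W (a, b)) = U (0, 0)"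
      using zero that U_M B_U[of "(a, b)"] by (simp add: zero_operator_def compression_M) (simp add: U_def)
    thus ?thesis
      by (rule inj_onD[OF U_inj]) (use W_K[of "(a, b)"] that KD(2) in auto)
  qed
  from this[OF _ KD(2)] this[OF KD(2)]
  show "zero_operator K (TTO \<theta> g) \<and> zero_operator K (TTO \<theta> g12) \<and> zero_operator K (TTO \<theta> g21)"
    by (simp add: zero_operator_def W_simp T0)
next
  assume "zero_operator K (TTO \<theta> g) \<and> zero_operator K (TTO \<theta> g12) \<and> zero_operator K (TTO \<theta> g21)"
  hence "W x = (0, 0)" if "x \<in> K \<times> K" for x
    using that by (auto simp: zero_operator_def W_simp)
  hence "B (U x) = 0" if "x \<in> K \<times> K" for x
    using that by (simp add: B_U) (simp add: U_def)
  note zero = this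
  show "zero_operator M (compression M g)"
    unfolding zero_operator_def compression_M
  proof
    fix f assume "f \<in> M"
    then obtain x where "x \<in> K \<times> K" "f = U x" unfolding M_eq by (rule imageE)
    thus "B f = 0" by (simp only: zero)
  qed
qed

end

theorem theorem2p3:
  fixes \<theta> \<phi> \<psi> g :: circle_fun
  assumes "inner_function \<theta>"
    and "\<phi> \<in> Linf" and "unimodular \<phi>"
    and "\<psi> \<in> Linf" and "unimodular \<psi>"
    and "orthogonal_sets (times_set \<phi> (model_space \<theta>)) (times_set \<psi> (model_space \<theta>))"
    and "\<not> (\<exists>c. \<phi> * cnj_fun \<psi> = const_fun c * \<theta>)"
    and "\<not> (\<exists>c. cnj_fun \<phi> * \<psi> = const_fun c * \<theta>)"
    and "g \<in> L2"
    and "bounded_compression (dual_band \<theta> \<phi> \<psi>) g"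
  shows
    "TTO_bounded \<theta> g \<and> TTO_bounded \<theta> (cnj_fun \<phi> * \<psi> * g) \<and>
     TTO_bounded \<theta> (cnj_fun \<psi> * \<phi> * g) \<and>
     unitarily_equivalent_sum
       (dual_band \<theta> \<phi> \<psi>) (compression (dual_band \<theta> \<phi> \<psi>) g)
       (model_space \<theta>)
       (block_operator
         (TTO \<theta> g)                         (TTO \<theta> (cnj_fun \<phi> * \<psi> * g))
         (TTO \<theta> (cnj_fun \<psi> * \<phi> * g))  (TTO \<theta> g)) \<and>
     (zero_operator (dual_band \<theta> \<phi> \<psi>) (compression (dual_band \<theta> \<phi> \<psi>) g) \<longleftrightarrow>
        zero_operator (model_space \<theta>) (TTO \<theta> g) \<and>
        zero_operator (model_space \<theta>) (TTO \<theta> (cnj_fun \<phi> * \<psi> * g)) \<and>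
        zero_operator (model_space \<theta>) (TTO \<theta> (cnj_fun \<psi> * \<phi> * g)) \<and>
        zero_operator (model_space \<theta>) (TTO \<theta> g))"
proof -
  interpret bounded_dual_band \<theta> \<phi> \<psi> g
    using assms by unfold_locales
  show ?thesis
    using entries_bounded compression_equivalent compression_zero_iff unfolding W_def by auto
qed

end
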